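(* Let $R$ be a commutative ring in which $2$ is invertible, and suppose that $R$ is not reduced (i.e. contains a nonzero nilpotent element). Then there exists a 2-nilpotent Lie algebra $\mathfrak{g}$ over $R$ (i.e. $[\mathfrak{g},[\mathfrak{g},\mathfrak{g}]]=\{0\}$) whose reduced Koszul homomorphism $\bar\eta:H_3(\mathfrak{g})\to\mathrm{Kill}(\mathfrak{g})$ is nonzero.
   Context: Tensor, exterior and symmetric powers are over $R$. $H_*(\mathfrak{g})$ is the homology of the Chevalley–Eilenberg complex $\Lambda^*\mathfrak{g}$ with $\partial_n(x_1\wedge\dots\wedge x_n)=\sum_{i<j}(-1)^{i+j}[x_i,x_j]\wedge x_1\wedge\dots\wedge\hat{x_i}\wedge\dots\wedge\hat{x_j}\wedge\dots\wedge x_n$, and $Z_3(\mathfrak{g})=\ker\partial_3$. Writing $x\odot y$ for the product in the symmetric square $S^2\mathfrak{g}$, the Killing module $\mathrm{Kill}(\mathfrak{g})$ is the cokernel of $\mathfrak{g}^{\otimes 3}\to S^2\mathfrak{g}$, $x\otimes y\otimes z\mapsto [x,y]\odot z-x\odot[y,z]$. The Koszul map $\eta:\Lambda^3\mathfrak{g}\to\mathrm{Kill}(\mathfrak{g})$ sends $x\wedge y\wedge z$ to the class of $x\odot[y,z]$; it vanishes on 3-boundaries, and the reduced Koszul map (homomorphism) $\bar\eta:H_3(\mathfrak{g})\to\mathrm{Kill}(\mathfrak{g})$ is induced by restricting $\eta$ to $Z_3(\mathfrak{g})$. *)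

theory Defs
  imports "HOL-Library.Multiset" "HOL-Algebra.AbelCoset" "HOL-Algebra.Module"
begin

definition reduced_ring :: "('a, 'm) ring_scheme \<Rightarrow> bool" where
  "reduced_ring R \<longleftrightarrow>
     (\<forall>a\<in>carrier R. (\<exists>n::nat. a [^]\<^bsub>R\<^esub> n = \<zero>\<^bsub>R\<^esub>) \<longrightarrow> a = \<zero>\<^bsub>R\<^esub>)"

section \<open>Linear algebra over a commutative ring\<close>

text \<open>As in the library, a module is a record extending a ring record, whose fields
  \<open>mult\<close> and \<open>one\<close> are irrelevant; they are left undefined below.\<close>

definition submodule_span ::
    "('a, 'm) ring_scheme \<Rightarrow> ('a, 'b, 'n) module_scheme \<Rightarrow> 'b set \<Rightarrow> 'b set" where
  "submodule_span R M S = \<Inter>{N. submodule N R M \<and> S \<subseteq> N}"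

definition quot_module ::
    "('a, 'b, 'n) module_scheme \<Rightarrow> 'b set \<Rightarrow> ('a, 'b set) module" where
  "quot_module M N =
     \<lparr>carrier = a_rcosets\<^bsub>M\<^esub> N, mult = undefined, one = undefined,
      zero = N, add = set_add M,
      smult = (\<lambda>r X. \<Union>x\<in>X. N +>\<^bsub>M\<^esub> (r \<odot>\<^bsub>M\<^esub> x))\<rparr>"

text \<open>The map induced on a quotient module by a map \<open>f\<close> that is constant on cosets,
  with the same encoding as in the library's \<open>group_hom.FactGroup_hom\<close>.\<close>

definition quot_map :: "('b \<Rightarrow> 'c) \<Rightarrow> 'b set \<Rightarrow> 'c" where
  "quot_map f X = the_elem (f ` X)"

definition free_module :: "('a, 'm) ring_scheme \<Rightarrow> 'x set \<Rightarrow> ('a, 'x \<Rightarrow> 'a) module" where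
  "free_module R X =
     \<lparr>carrier = {f. range f \<subseteq> carrier R \<and> finite {x. f x \<noteq> \<zero>\<^bsub>R\<^esub>} \<and> {x. f x \<noteq> \<zero>\<^bsub>R\<^esub>} \<subseteq> X},
      mult = undefined, one = undefined,
      zero = (\<lambda>x. \<zero>\<^bsub>R\<^esub>), add = (\<lambda>f g x. f x \<oplus>\<^bsub>R\<^esub> g x),
      smult = (\<lambda>r f x. r \<otimes>\<^bsub>R\<^esub> f x)\<rparr>"

definition free_gen :: "('a, 'm) ring_scheme \<Rightarrow> 'x \<Rightarrow> 'x \<Rightarrow> 'a" where
  "free_gen R x = (\<lambda>y. if y = x then \<one>\<^bsub>R\<^esub> else \<zero>\<^bsub>R\<^esub>)"

text \<open>The linear map from a free module to \<open>P\<close> with value \<open>\<phi> x\<close> on the generator \<open>x\<close>.\<close>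

definition linear_ext ::
    "('a, 'm) ring_scheme \<Rightarrow> ('a, 'c, 'n) module_scheme \<Rightarrow> ('x \<Rightarrow> 'c) \<Rightarrow> ('x \<Rightarrow> 'a) \<Rightarrow> 'c" where
  "linear_ext R P \<phi> f = (\<Oplus>\<^bsub>P\<^esub>x\<in>{x. f x \<noteq> \<zero>\<^bsub>R\<^esub>}. f x \<odot>\<^bsub>P\<^esub> \<phi> x)"

section \<open>Tensor, exterior and symmetric powers\<close>

text \<open>Each power \<open>M\<^sup>n\<close> is the free module on the \<open>n\<close>-tuples (lists of length \<open>n\<close>) of elements
  of \<open>M\<close>, modulo the multilinearity relations and, for exterior and symmetric powers, the
  alternating and the symmetry relations.\<close>

definition tuples :: "('a, 'b, 'n) module_scheme \<Rightarrow> nat \<Rightarrow> 'b list set" where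
  "tuples M n = {xs. length xs = n \<and> set xs \<subseteq> carrier M}"

definition multilinear_rels ::
    "('a, 'm) ring_scheme \<Rightarrow> ('a, 'b, 'n) module_scheme \<Rightarrow> nat \<Rightarrow> ('b list \<Rightarrow> 'a) set" where
  "multilinear_rels R M n =
     (let F = free_module R (tuples M n); e = free_gen R in
       {e (us @ (x \<oplus>\<^bsub>M\<^esub> y) # vs) \<ominus>\<^bsub>F\<^esub> (e (us @ x # vs) \<oplus>\<^bsub>F\<^esub> e (us @ y # vs)) | us vs x y.
          us @ x # vs \<in> tuples M n \<and> us @ y # vs \<in> tuples M n} \<union>
       {e (us @ (r \<odot>\<^bsub>M\<^esub> x) # vs) \<ominus>\<^bsub>F\<^esub> r \<odot>\<^bsub>F\<^esub> e (us @ x # vs) | us vs r x.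
          us @ x # vs \<in> tuples M n \<and> r \<in> carrier R})"

definition alternating_rels ::
    "('a, 'm) ring_scheme \<Rightarrow> ('a, 'b, 'n) module_scheme \<Rightarrow> nat \<Rightarrow> ('b list \<Rightarrow> 'a) set" where
  "alternating_rels R M n = {free_gen R xs | xs. xs \<in> tuples M n \<and> \<not> distinct xs}"

definition symmetric_rels ::
    "('a, 'm) ring_scheme \<Rightarrow> ('a, 'b, 'n) module_scheme \<Rightarrow> nat \<Rightarrow> ('b list \<Rightarrow> 'a) set" where
  "symmetric_rels R M n =
     {free_gen R xs \<ominus>\<^bsub>free_module R (tuples M n)\<^esub> free_gen R ys | xs ys.
        xs \<in> tuples M n \<and> mset ys = mset xs}"

definition power_rel ::
    "('a, 'm) ring_scheme \<Rightarrow> ('a, 'b, 'n) module_scheme \<Rightarrow> nat \<Rightarrow> ('b list \<Rightarrow> 'a) set \<Rightarrow>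
       ('b list \<Rightarrow> 'a) set" where
  "power_rel R M n S =
     submodule_span R (free_module R (tuples M n)) (multilinear_rels R M n \<union> S)"

definition tensor_power ::
    "('a, 'm) ring_scheme \<Rightarrow> ('a, 'b, 'n) module_scheme \<Rightarrow> nat \<Rightarrow> ('a, ('b list \<Rightarrow> 'a) set) module" where
  "tensor_power R M n = quot_module (free_module R (tuples M n)) (power_rel R M n {})"

definition ext_power ::
    "('a, 'm) ring_scheme \<Rightarrow> ('a, 'b, 'n) module_scheme \<Rightarrow> nat \<Rightarrow> ('a, ('b list \<Rightarrow> 'a) set) module" where
  "ext_power R M n =
     quot_module (free_module R (tuples M n)) (power_rel R M n (alternating_rels R M n))"

definition sym_power ::
    "('a, 'm) ring_scheme \<Rightarrow> ('a, 'b, 'n) module_scheme \<Rightarrow> nat \<Rightarrow> ('a, ('b list \<Rightarrow> 'a) set) module" where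
  "sym_power R M n =
     quot_module (free_module R (tuples M n)) (power_rel R M n (symmetric_rels R M n))"

text \<open>\<open>wedge R M [x\<^sub>1, \<dots>, x\<^sub>n]\<close> is \<open>x\<^sub>1 \<and> \<dots> \<and> x\<^sub>n\<close>, and \<open>sym_prod R M x y\<close> is the
  product of \<open>x\<close> and \<open>y\<close> in the symmetric square.\<close>

definition wedge ::
    "('a, 'm) ring_scheme \<Rightarrow> ('a, 'b, 'n) module_scheme \<Rightarrow> 'b list \<Rightarrow> ('b list \<Rightarrow> 'a) set" where
  "wedge R M xs =
     (let n = length xs in
       power_rel R M n (alternating_rels R M n) +>\<^bsub>free_module R (tuples M n)\<^esub> free_gen R xs)"

definition sym_prod ::
    "('a, 'm) ring_scheme \<Rightarrow> ('a, 'b, 'n) module_scheme \<Rightarrow> 'b \<Rightarrow> 'b \<Rightarrow> ('b list \<Rightarrow> 'a) set" where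
  "sym_prod R M x y =
     power_rel R M 2 (symmetric_rels R M 2) +>\<^bsub>free_module R (tuples M 2)\<^esub> free_gen R [x, y]"

section \<open>Lie algebras\<close>

record ('a, 'b) lie_alg = "('a, 'b) module" +
  lie_bracket :: "'b \<Rightarrow> 'b \<Rightarrow> 'b"

locale lie_algebra = module R L
  for R :: "('a, 'm) ring_scheme" (structure) and L :: "('a, 'b, 'n) lie_alg_scheme" (structure) +
  assumes bracket_closed:
      "\<lbrakk>x \<in> carrier L; y \<in> carrier L\<rbrakk> \<Longrightarrow> lie_bracket L x y \<in> carrier L"
    and bracket_add_left:
      "\<lbrakk>x \<in> carrier L; y \<in> carrier L; z \<in> carrier L\<rbrakk> \<Longrightarrow>
        lie_bracket L (x \<oplus>\<^bsub>L\<^esub> y) z = lie_bracket L x z \<oplus>\<^bsub>L\<^esub> lie_bracket L y z"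
    and bracket_add_right:
      "\<lbrakk>x \<in> carrier L; y \<in> carrier L; z \<in> carrier L\<rbrakk> \<Longrightarrow>
        lie_bracket L x (y \<oplus>\<^bsub>L\<^esub> z) = lie_bracket L x y \<oplus>\<^bsub>L\<^esub> lie_bracket L x z"
    and bracket_smult_left:
      "\<lbrakk>r \<in> carrier R; x \<in> carrier L; y \<in> carrier L\<rbrakk> \<Longrightarrow>
        lie_bracket L (r \<odot>\<^bsub>L\<^esub> x) y = r \<odot>\<^bsub>L\<^esub> lie_bracket L x y"
    and bracket_smult_right:
      "\<lbrakk>r \<in> carrier R; x \<in> carrier L; y \<in> carrier L\<rbrakk> \<Longrightarrow>
        lie_bracket L x (r \<odot>\<^bsub>L\<^esub> y) = r \<odot>\<^bsub>L\<^esub> lie_bracket L x y"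
    and bracket_self: "x \<in> carrier L \<Longrightarrow> lie_bracket L x x = \<zero>\<^bsub>L\<^esub>"
    and jacobi:
      "\<lbrakk>x \<in> carrier L; y \<in> carrier L; z \<in> carrier L\<rbrakk> \<Longrightarrow>
        lie_bracket L x (lie_bracket L y z) \<oplus>\<^bsub>L\<^esub> lie_bracket L y (lie_bracket L z x)
          \<oplus>\<^bsub>L\<^esub> lie_bracket L z (lie_bracket L x y) = \<zero>\<^bsub>L\<^esub>"

text \<open>The submodule \<open>[A, B]\<close> generated by all brackets.\<close>

definition bracket_span ::
    "('a, 'm) ring_scheme \<Rightarrow> ('a, 'b, 'n) lie_alg_scheme \<Rightarrow> 'b set \<Rightarrow> 'b set \<Rightarrow> 'b set" where
  "bracket_span R L A B = submodule_span R L {lie_bracket L x y | x y. x \<in> A \<and> y \<in> B}"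

definition two_nilpotent :: "('a, 'm) ring_scheme \<Rightarrow> ('a, 'b, 'n) lie_alg_scheme \<Rightarrow> bool" where
  "two_nilpotent R L \<longleftrightarrow>
     bracket_span R L (carrier L) (bracket_span R L (carrier L) (carrier L)) = {\<zero>\<^bsub>L\<^esub>}"

section \<open>Chevalley--Eilenberg homology\<close>

text \<open>Indices count from \<open>0\<close> here, which does not change the sign \<open>(-1)\<^bsup>i+j\<^esup>\<close>.  The sum is
  empty for \<open>n \<le> 1\<close>, so the degenerate index \<open>n - 1 = 0\<close> for \<open>n = 0\<close> is harmless: the
  differential out of degree \<open>0\<close> is the zero map.\<close>

definition ce_boundary ::
    "('a, 'm) ring_scheme \<Rightarrow> ('a, 'b, 'n) lie_alg_scheme \<Rightarrow> nat \<Rightarrow>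
       ('b list \<Rightarrow> 'a) set \<Rightarrow> ('b list \<Rightarrow> 'a) set" where
  "ce_boundary R L n =
     quot_map (linear_ext R (ext_power R L (n - 1))
       (\<lambda>xs. \<Oplus>\<^bsub>ext_power R L (n - 1)\<^esub>j\<in>{..<n}. \<Oplus>\<^bsub>ext_power R L (n - 1)\<^esub>i\<in>{..<j}.
          ((\<ominus>\<^bsub>R\<^esub> \<one>\<^bsub>R\<^esub>) [^]\<^bsub>R\<^esub> (i + j)) \<odot>\<^bsub>ext_power R L (n - 1)\<^esub>
            wedge R L (lie_bracket L (xs ! i) (xs ! j) # nths xs (- {i, j}))))"

definition ce_cycles ::
    "('a, 'm) ring_scheme \<Rightarrow> ('a, 'b, 'n) lie_alg_scheme \<Rightarrow> nat \<Rightarrow> ('b list \<Rightarrow> 'a) set set" where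
  "ce_cycles R L n = a_kernel (ext_power R L n) (ext_power R L (n - 1)) (ce_boundary R L n)"

definition ce_boundaries ::
    "('a, 'm) ring_scheme \<Rightarrow> ('a, 'b, 'n) lie_alg_scheme \<Rightarrow> nat \<Rightarrow> ('b list \<Rightarrow> 'a) set set" where
  "ce_boundaries R L n = ce_boundary R L (Suc n) ` carrier (ext_power R L (Suc n))"

definition ce_homology ::
    "('a, 'm) ring_scheme \<Rightarrow> ('a, 'b, 'n) lie_alg_scheme \<Rightarrow> nat \<Rightarrow>
       ('a, ('b list \<Rightarrow> 'a) set set) module" where
  "ce_homology R L n =
     quot_module ((ext_power R L n)\<lparr>carrier := ce_cycles R L n\<rparr>) (ce_boundaries R L n)"

section \<open>The Killing module and the Koszul map\<close>

definition kill_rel_map ::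
    "('a, 'm) ring_scheme \<Rightarrow> ('a, 'b, 'n) lie_alg_scheme \<Rightarrow>
       ('b list \<Rightarrow> 'a) set \<Rightarrow> ('b list \<Rightarrow> 'a) set" where
  "kill_rel_map R L =
     quot_map (linear_ext R (sym_power R L 2)
       (\<lambda>xs. sym_prod R L (lie_bracket L (xs ! 0) (xs ! 1)) (xs ! 2)
          \<ominus>\<^bsub>sym_power R L 2\<^esub> sym_prod R L (xs ! 0) (lie_bracket L (xs ! 1) (xs ! 2))))"

definition kill_rel ::
    "('a, 'm) ring_scheme \<Rightarrow> ('a, 'b, 'n) lie_alg_scheme \<Rightarrow> ('b list \<Rightarrow> 'a) set set" where
  "kill_rel R L = kill_rel_map R L ` carrier (tensor_power R L 3)"

definition kill_module ::
    "('a, 'm) ring_scheme \<Rightarrow> ('a, 'b, 'n) lie_alg_scheme \<Rightarrow>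
       ('a, ('b list \<Rightarrow> 'a) set set) module" where
  "kill_module R L = quot_module (sym_power R L 2) (kill_rel R L)"

definition koszul_map ::
    "('a, 'm) ring_scheme \<Rightarrow> ('a, 'b, 'n) lie_alg_scheme \<Rightarrow>
       ('b list \<Rightarrow> 'a) set \<Rightarrow> ('b list \<Rightarrow> 'a) set set" where
  "koszul_map R L =
     quot_map (linear_ext R (kill_module R L)
       (\<lambda>xs. kill_rel R L +>\<^bsub>sym_power R L 2\<^esub>
          sym_prod R L (xs ! 0) (lie_bracket L (xs ! 1) (xs ! 2))))"

text \<open>Its argument is a coset of 3-boundaries inside the 3-cycles.\<close>

definition reduced_koszul_map ::
    "('a, 'm) ring_scheme \<Rightarrow> ('a, 'b, 'n) lie_alg_scheme \<Rightarrow>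
       ('b list \<Rightarrow> 'a) set set \<Rightarrow> ('b list \<Rightarrow> 'a) set set" where
  "reduced_koszul_map R L = quot_map (koszul_map R L)"

end

theory Submission
  imports Defs
begin

text \<open>A ring that is not reduced contains \<open>t \<noteq> 0\<close> with \<open>t\<^sup>2 = 0\<close>.  On \<open>R\<^sup>3\<close>, with standard basis
  \<open>p, q, r\<close>, take the bracket \<open>[x, y] = t (x \<times> y)\<close>, where \<open>\<times>\<close> is the cross product; double brackets
  vanish because \<open>t\<^sup>2 = 0\<close>.  The element \<open>p \<and> q \<and> r\<close> is a cycle, as each term of its boundary is a
  multiple of \<open>r \<and> r\<close>, \<open>q \<and> q\<close> or \<open>p \<and> p\<close>, and its image under the Koszul map is the class of
  \<open>t p \<odot> p\<close>.  The dot product is invariant, so it factors through the Killing module; it takes the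
  value \<open>t \<noteq> 0\<close> on that class.\<close>

section \<open>Linear maps, quotients and free modules\<close>

text \<open>The construction deforms a classical fact. For the cross product, the form x \<cdot> (y
  \<times> z) is the determinant, which is Cartan's 3-form on so(3); over the reals it detects H_3.
  Scaling the bracket by \<open>t\<close> scales this form by \<open>t\<close>, so that it stays
  nonzero, while every double bracket acquires the factor \<open>t \<otimes> t\<close>.

  The Killing module is a quotient of a quotient of a free module, where a class is hard to
  recognise as nonzero; a linear functional on it does so. Such functionals amount to symmetric
  bilinear forms that are invariant under the bracket, and invariance of the dot product is the
  cyclic symmetry of the determinant.

  That the Koszul map kills 3-boundaries is proved here for algebras with vanishing double brackets:
  every term of a boundary contains a bracket, and [x,y] \<odot> [u,v] = x \<odot> [y,[u,v]] = 0 in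
  the Killing module.

  Most of the labour is well-definedness. Every map is given by a formula on representatives and can
  be evaluated only once it is known to be constant on cosets; for the boundary this means proving
  it alternating in degrees 3 and 4.\<close>

locale linear_map = M: module R M + P: module R P
  for R :: "('a, 'm) ring_scheme" and M :: "('a, 'b, 'n) module_scheme"
    and P :: "('a, 'c, 'p) module_scheme" +
  fixes f :: "'b \<Rightarrow> 'c"
  assumes closed [simp, intro]: "x \<in> carrier M \<Longrightarrow> f x \<in> carrier P"
    and map_add: "\<lbrakk>x \<in> carrier M; y \<in> carrier M\<rbrakk> \<Longrightarrow> f (x \<oplus>\<^bsub>M\<^esub> y) = f x \<oplus>\<^bsub>P\<^esub> f y"
    and map_smult: "\<lbrakk>r \<in> carrier R; x \<in> carrier M\<rbrakk> \<Longrightarrow> f (r \<odot>\<^bsub>M\<^esub> x) = r \<odot>\<^bsub>P\<^esub> f x"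
begin

lemma map_zero [simp]: "f \<zero>\<^bsub>M\<^esub> = \<zero>\<^bsub>P\<^esub>"
  using map_smult[of "\<zero>\<^bsub>R\<^esub>" "\<zero>\<^bsub>M\<^esub>"] by simp

lemma map_minus: "x \<in> carrier M \<Longrightarrow> f (\<ominus>\<^bsub>M\<^esub> x) = \<ominus>\<^bsub>P\<^esub> f x"
  using map_smult[of "\<ominus>\<^bsub>R\<^esub> \<one>\<^bsub>R\<^esub>" x] by (simp add: M.smult_l_minus P.smult_l_minus)

lemma map_diff: "\<lbrakk>x \<in> carrier M; y \<in> carrier M\<rbrakk> \<Longrightarrow> f (x \<ominus>\<^bsub>M\<^esub> y) = f x \<ominus>\<^bsub>P\<^esub> f y"
  by (simp add: a_minus_def map_add map_minus)

lemma kernel_submodule: "submodule {x \<in> carrier M. f x = \<zero>\<^bsub>P\<^esub>} R M"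
  by (rule M.submoduleI) (auto simp: map_add map_smult map_minus)

lemma image_submodule: "submodule (f ` carrier M) R P"
proof (rule P.submoduleI)
  show "\<zero>\<^bsub>P\<^esub> \<in> f ` carrier M" using map_zero M.M.zero_closed by (metis imageI)
next
  fix y z assume "y \<in> f ` carrier M" "z \<in> f ` carrier M"
  then show "y \<oplus>\<^bsub>P\<^esub> z \<in> f ` carrier M" by (force simp: map_add[symmetric])
next
  fix y assume "y \<in> f ` carrier M"
  then show "\<ominus>\<^bsub>P\<^esub> y \<in> f ` carrier M" by (force simp: map_minus[symmetric])
next
  fix r y assume "r \<in> carrier R" "y \<in> f ` carrier M"
  then show "r \<odot>\<^bsub>P\<^esub> y \<in> f ` carrier M" by (force simp: map_smult[symmetric])
qed auto

end

lemma linear_map_comp: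
  assumes "linear_map R M P f" "linear_map R P Q g"
  shows "linear_map R M Q (\<lambda>x. g (f x))"
proof -
  interpret f: linear_map R M P f by fact
  interpret g: linear_map R P Q g by fact
  show ?thesis by unfold_locales (auto simp: f.map_add f.map_smult g.map_add g.map_smult)
qed

context module
begin

text \<open>With \<open>S \<subseteq> carrier M\<close> the whole module belongs to the family being
  intersected; an intersection over an empty family would be the whole type.\<close>

lemma submodule_span_submodule:
  assumes "S \<subseteq> carrier M"
  shows "submodule (submodule_span R M S) R M"
proof -
  have *: "submodule N R M \<Longrightarrow> N \<subseteq> carrier M" "submodule N R M \<Longrightarrow> \<zero>\<^bsub>M\<^esub> \<in> N" for N
    using submoduleE(1) subgroup.one_closed[OF submodule.axioms(1)] by fastforce+
  show ?thesis
    unfolding submodule_span_def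
    by (rule submoduleI)
      (use carrier_is_submodule assms * submoduleE(3-5) in \<open>auto dest: submodule.smult_closed\<close>)
qed

lemma submodule_span_incl: "S \<subseteq> submodule_span R M S"
  by (auto simp: submodule_span_def)

lemma submodule_span_least: "\<lbrakk>submodule N R M; S \<subseteq> N\<rbrakk> \<Longrightarrow> submodule_span R M S \<subseteq> N"
  by (auto simp: submodule_span_def)

lemma submodule_zero: "submodule N R M \<Longrightarrow> \<zero>\<^bsub>M\<^esub> \<in> N"
  using subgroup.one_closed[OF submodule.axioms(1)] by fastforce

end

section \<open>Quotients of modules and the maps they induce\<close>

locale quotient_module = module R M + N: submodule N R M
  for R :: "('a, 'm) ring_scheme" (structure) and M :: "('a, 'b, 'n) module_scheme" (structure)
    and N :: "'b set"
begin

abbreviation Q where "Q \<equiv> quot_module M N"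

sublocale sub: abelian_subgroup N M
  by (intro abelian_subgroupI3 additive_subgroupI N.subgroup_axioms abelian_group_axioms)

lemma quot_add: "\<lbrakk>x \<in> carrier M; y \<in> carrier M\<rbrakk> \<Longrightarrow>
    (N +>\<^bsub>M\<^esub> x) \<oplus>\<^bsub>Q\<^esub> (N +>\<^bsub>M\<^esub> y) = N +>\<^bsub>M\<^esub> (x \<oplus>\<^bsub>M\<^esub> y)"
  by (simp add: quot_module_def sub.a_rcos_sum)

lemma quot_zero: "\<zero>\<^bsub>Q\<^esub> = N"
  by (simp add: quot_module_def)

lemma quot_carrier: "carrier Q = (\<lambda>x. N +>\<^bsub>M\<^esub> x) ` carrier M"
  by (auto simp: quot_module_def A_RCOSETS_def')

lemma coset_eq_zero_iff:
  assumes "x \<in> carrier M" shows "N +>\<^bsub>M\<^esub> x = \<zero>\<^bsub>Q\<^esub> \<longleftrightarrow> x \<in> N"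
  using assms M.a_coset_join2[OF assms N.subgroup_axioms] sub.a_rcos_self[OF assms]
  by (auto simp: quot_zero)

lemma coset_eqI:
  assumes "x \<in> carrier M" "y \<in> carrier M" "x \<ominus>\<^bsub>M\<^esub> y \<in> N"
  shows "N +>\<^bsub>M\<^esub> x = N +>\<^bsub>M\<^esub> y"
proof -
  have "x = (x \<ominus>\<^bsub>M\<^esub> y) \<oplus>\<^bsub>M\<^esub> y"
    using assms by (simp add: M.minus_eq M.a_assoc M.l_neg)
  then have "x \<in> N +>\<^bsub>M\<^esub> y" using assms(3) by (auto simp: a_r_coset_def')
  then show ?thesis using assms(2) sub.a_repr_independence' by metis
qed

lemma coset_memD:
  assumes "x \<in> carrier M" "z \<in> N +>\<^bsub>M\<^esub> x"
  obtains n where "n \<in> N" "n \<in> carrier M" "z = n \<oplus>\<^bsub>M\<^esub> x"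
  using assms sub.a_Hcarr by (auto simp: a_r_coset_def')

text \<open>The scalar action on the quotient is a union of cosets, one for each representative
  \<open>y\<close>. They all coincide: \<open>y\<close> differs from \<open>x\<close> by some
  \<open>n\<close> in \<open>N\<close>, and \<open>r \<odot> n\<close> lies in \<open>N\<close>
  again.\<close>

lemma quot_smult:
  assumes "r \<in> carrier R" "x \<in> carrier M"
  shows "r \<odot>\<^bsub>Q\<^esub> (N +>\<^bsub>M\<^esub> x) = N +>\<^bsub>M\<^esub> (r \<odot>\<^bsub>M\<^esub> x)"
proof -
  have "N +>\<^bsub>M\<^esub> (r \<odot>\<^bsub>M\<^esub> y) = N +>\<^bsub>M\<^esub> (r \<odot>\<^bsub>M\<^esub> x)" if y: "y \<in> N +>\<^bsub>M\<^esub> x" for y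
  proof -
    obtain n where n: "n \<in> N" "n \<in> carrier M" "y = n \<oplus>\<^bsub>M\<^esub> x"
      using coset_memD[OF assms(2) y] .
    have "r \<odot>\<^bsub>M\<^esub> y \<ominus>\<^bsub>M\<^esub> r \<odot>\<^bsub>M\<^esub> x = r \<odot>\<^bsub>M\<^esub> n"
      using n assms by (simp add: smult_r_distr M.minus_eq M.a_assoc M.r_neg)
    then show ?thesis using n assms by (intro coset_eqI) auto
  qed
  moreover have "x \<in> N +>\<^bsub>M\<^esub> x" using assms(2) by (rule sub.a_rcos_self)
  ultimately have "(\<Union>y\<in>N +>\<^bsub>M\<^esub> x. N +>\<^bsub>M\<^esub> (r \<odot>\<^bsub>M\<^esub> y)) = N +>\<^bsub>M\<^esub> (r \<odot>\<^bsub>M\<^esub> x)"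
    by (intro SUP_eq_const) blast+
  then show ?thesis by (simp add: quot_module_def)
qed

lemma quot_module: "module R Q"
proof (intro moduleI abelian_groupI R.is_cring)
  show "\<exists>y\<in>carrier Q. y \<oplus>\<^bsub>Q\<^esub> x = \<zero>\<^bsub>Q\<^esub>" if "x \<in> carrier Q" for x
  proof -
    obtain a where a: "a \<in> carrier M" "x = N +>\<^bsub>M\<^esub> a" using \<open>x \<in> carrier Q\<close> unfolding quot_carrier by blast
    then have "(N +>\<^bsub>M\<^esub> (\<ominus>\<^bsub>M\<^esub> a)) \<oplus>\<^bsub>Q\<^esub> x = \<zero>\<^bsub>Q\<^esub>"
      by (simp add: quot_add M.l_neg coset_eq_zero_iff)
    then show ?thesis using a unfolding quot_carrier by blast
  qed
  \<comment> \<open>The zero of the quotient is the set \<open>N\<close> itself; written as a coset,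
    it is covered by \<open>quot_add\<close>.\<close>
  have N: "\<zero>\<^bsub>Q\<^esub> = N +>\<^bsub>M\<^esub> \<zero>\<^bsub>M\<^esub>" using coset_eq_zero_iff[of "\<zero>\<^bsub>M\<^esub>"] by simp
  then show "\<zero>\<^bsub>Q\<^esub> \<in> carrier Q" unfolding quot_carrier by simp
  show "\<zero>\<^bsub>Q\<^esub> \<oplus>\<^bsub>Q\<^esub> x = x" if "x \<in> carrier Q" for x
    using that unfolding N quot_carrier by (auto simp: quot_add simp del: M.a_coset_add_zero)
qed (auto simp: quot_carrier quot_add quot_smult smult_l_distr smult_r_distr smult_assoc1 M.a_ac)

lemma coset_linear: "linear_map R M Q (\<lambda>x. N +>\<^bsub>M\<^esub> x)"
  by (intro linear_map.intro linear_map_axioms.intro quot_module module_axioms)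
    (auto simp: quot_carrier quot_add quot_smult)

text \<open>\<open>quot_map\<close> extracts the only element of an image, so it has a usable value
  just when \<open>f\<close> is constant on the coset; a linear map is, as soon as it vanishes on
  \<open>N\<close>. All later evaluations of induced maps on powers rest on this.\<close>

lemma quot_map_coset:
  assumes "linear_map R M P f" "\<And>n. n \<in> N \<Longrightarrow> f n = \<zero>\<^bsub>P\<^esub>" "x \<in> carrier M"
  shows "quot_map f (N +>\<^bsub>M\<^esub> x) = f x"
proof -
  interpret f: linear_map R M P f by fact
  have "f y = f x" if "y \<in> N +>\<^bsub>M\<^esub> x" for y
    using coset_memD[OF assms(3) that] assms(2,3) by (metis f.closed f.map_add f.P.l_zero)
  then have "f ` (N +>\<^bsub>M\<^esub> x) = (\<lambda>_. f x) ` (N +>\<^bsub>M\<^esub> x)" by (rule image_cong[OF refl])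
  also have "\<dots> = {f x}" using sub.a_rcos_self[OF assms(3)] by blast
  finally have "f ` (N +>\<^bsub>M\<^esub> x) = {f x}" .
  then show ?thesis by (simp add: quot_map_def)
qed

lemma quot_map_linear:
  assumes "linear_map R M P f" "\<And>n. n \<in> N \<Longrightarrow> f n = \<zero>\<^bsub>P\<^esub>"
  shows "linear_map R Q P (quot_map f)"
proof -
  interpret f: linear_map R M P f by fact
  show ?thesis
    by (intro linear_map.intro linear_map_axioms.intro quot_module f.P.module_axioms)
      (auto simp: quot_carrier quot_add quot_smult quot_map_coset[OF assms] f.map_add f.map_smult)
qed

end

section \<open>Free modules and linear extension from generators\<close>

lemma free_gen_carrier:
  assumes "cring R" "x \<in> X" shows "free_gen R x \<in> carrier (free_module R X)"
proof -
  interpret cring R by fact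
  have "{y. free_gen R x y \<noteq> \<zero>\<^bsub>R\<^esub>} \<subseteq> {x}" by (auto simp: free_gen_def)
  then show ?thesis using assms(2) finite_subset by (fastforce simp: free_module_def free_gen_def)
qed

lemma free_module_sel:
  "\<zero>\<^bsub>free_module R X\<^esub> = (\<lambda>x. \<zero>\<^bsub>R\<^esub>)"
  "f \<oplus>\<^bsub>free_module R X\<^esub> g = (\<lambda>x. f x \<oplus>\<^bsub>R\<^esub> g x)"
  "r \<odot>\<^bsub>free_module R X\<^esub> f = (\<lambda>x. r \<otimes>\<^bsub>R\<^esub> f x)"
  by (simp_all add: free_module_def)

lemma free_module_carrier_iff:
  "f \<in> carrier (free_module R X) \<longleftrightarrow>
     (\<forall>x. f x \<in> carrier R) \<and> finite {x. f x \<noteq> \<zero>\<^bsub>R\<^esub>} \<and> {x. f x \<noteq> \<zero>\<^bsub>R\<^esub>} \<subseteq> X"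
  by (auto simp: free_module_def)

lemma free_module_module:
  assumes "cring R" shows "module R (free_module R X)"
proof -
  interpret cring R by fact
  have *: "f \<in> carrier (free_module R X)"
    if "\<And>x. f x \<in> carrier R" "finite A" "A \<subseteq> X" "\<And>x. x \<notin> A \<Longrightarrow> f x = \<zero>\<^bsub>R\<^esub>" for f A
  proof -
    have "{x. f x \<noteq> \<zero>\<^bsub>R\<^esub>} \<subseteq> A" using that by auto
    then show ?thesis using that finite_subset by (fastforce simp: free_module_carrier_iff)
  qed
  show ?thesis
  proof (intro moduleI abelian_groupI assms)
    fix f g assume "f \<in> carrier (free_module R X)" "g \<in> carrier (free_module R X)"
    then show "f \<oplus>\<^bsub>free_module R X\<^esub> g \<in> carrier (free_module R X)"
      by (intro *[of _ "{x. f x \<noteq> \<zero>\<^bsub>R\<^esub>} \<union> {x. g x \<noteq> \<zero>\<^bsub>R\<^esub>}"])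
        (auto simp: free_module_sel free_module_carrier_iff)
  next
    fix r f assume "r \<in> carrier R" "f \<in> carrier (free_module R X)"
    then show "r \<odot>\<^bsub>free_module R X\<^esub> f \<in> carrier (free_module R X)"
      by (intro *[of _ "{x. f x \<noteq> \<zero>\<^bsub>R\<^esub>}"])
        (auto simp: free_module_sel free_module_carrier_iff)
  next
    fix f assume "f \<in> carrier (free_module R X)"
    then have "(\<lambda>x. \<ominus>\<^bsub>R\<^esub> f x) \<in> carrier (free_module R X)"
      "(\<lambda>x. \<ominus>\<^bsub>R\<^esub> f x) \<oplus>\<^bsub>free_module R X\<^esub> f = \<zero>\<^bsub>free_module R X\<^esub>"
      by (auto intro!: *[of _ "{x. f x \<noteq> \<zero>\<^bsub>R\<^esub>}"] simp: free_module_sel free_module_carrier_iff l_neg)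
    then show "\<exists>g\<in>carrier (free_module R X). g \<oplus>\<^bsub>free_module R X\<^esub> f = \<zero>\<^bsub>free_module R X\<^esub>"
      by blast
  qed (auto simp: free_module_sel free_module_carrier_iff l_distr r_distr m_assoc a_ac)
qed

text \<open>The defining sum runs over the support of \<open>f\<close>, which may shrink under
  addition (cancellation) or scaling (zero divisors). Summing over any finite superset
  \<open>A\<close> of the support gives the same value and lets sums be compared term by
  term.\<close>

lemma (in module) linear_ext_eq:
  assumes "\<phi> \<in> X \<rightarrow> carrier M" "f \<in> carrier (free_module R X)"
    "finite A" "A \<subseteq> X" "{x. f x \<noteq> \<zero>} \<subseteq> A"
  shows "linear_ext R M \<phi> f = (\<Oplus>\<^bsub>M\<^esub>x\<in>A. f x \<odot>\<^bsub>M\<^esub> \<phi> x)"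
proof -
  have *: "f x \<in> carrier R" "x \<in> A \<Longrightarrow> \<phi> x \<in> carrier M" for x
    using assms(1,2,4) by (auto simp: free_module_carrier_iff)
  then have "f x \<odot>\<^bsub>M\<^esub> \<phi> x = \<zero>\<^bsub>M\<^esub>" if "x \<in> A - {x. f x \<noteq> \<zero>}" for x
    using that by simp
  then show ?thesis
    unfolding linear_ext_def using assms(3,5) * by (intro M.add.finprod_mono_neutral_cong_left) auto
qed

lemma (in module) linear_ext_linear:
  assumes "\<phi> \<in> X \<rightarrow> carrier M"
  shows "linear_map R (free_module R X) M (linear_ext R M \<phi>)"
proof (intro linear_map.intro linear_map_axioms.intro free_module_module module_axioms R.is_cring)
  let ?F = "free_module R X" and ?s = "\<lambda>f. {x. f x \<noteq> \<zero>}"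
  interpret F: module R ?F by (intro free_module_module R.is_cring)
  have fin: "finite (?s f)" "?s f \<subseteq> X" "f x \<in> carrier R" if "f \<in> carrier ?F" for f x
    using that by (auto simp: free_module_carrier_iff)
  show "linear_ext R M \<phi> f \<in> carrier M" if f: "f \<in> carrier ?F" for f
    unfolding linear_ext_def using fin[OF f] assms by (auto intro!: M.finsum_closed)
  show "linear_ext R M \<phi> (f \<oplus>\<^bsub>?F\<^esub> g) = linear_ext R M \<phi> f \<oplus>\<^bsub>M\<^esub> linear_ext R M \<phi> g"
    if f: "f \<in> carrier ?F" and g: "g \<in> carrier ?F" for f g
  proof -
    let ?A = "?s f \<union> ?s g"
    have A: "finite ?A" "?A \<subseteq> X" using fin f g by auto
    have \<phi>: "\<phi> x \<in> carrier M" if "x \<in> ?A" for x using A(2) that assms by blast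
    have "linear_ext R M \<phi> (f \<oplus>\<^bsub>?F\<^esub> g) = (\<Oplus>\<^bsub>M\<^esub>x\<in>?A. (f x \<oplus> g x) \<odot>\<^bsub>M\<^esub> \<phi> x)"
      using linear_ext_eq[OF assms F.a_closed[OF f g] A] by (force simp: free_module_sel)
    also have "\<dots> = (\<Oplus>\<^bsub>M\<^esub>x\<in>?A. f x \<odot>\<^bsub>M\<^esub> \<phi> x \<oplus>\<^bsub>M\<^esub> g x \<odot>\<^bsub>M\<^esub> \<phi> x)"
      using fin(3)[OF f] fin(3)[OF g] \<phi> by (intro M.finsum_cong') (auto simp: smult_l_distr)
    also have "\<dots> = (\<Oplus>\<^bsub>M\<^esub>x\<in>?A. f x \<odot>\<^bsub>M\<^esub> \<phi> x) \<oplus>\<^bsub>M\<^esub> (\<Oplus>\<^bsub>M\<^esub>x\<in>?A. g x \<odot>\<^bsub>M\<^esub> \<phi> x)"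
      using fin(3)[OF f] fin(3)[OF g] \<phi> by (intro M.finsum_addf) auto
    finally show ?thesis
      using linear_ext_eq[OF assms f A] linear_ext_eq[OF assms g A] by simp
  qed
  show "linear_ext R M \<phi> (r \<odot>\<^bsub>?F\<^esub> f) = r \<odot>\<^bsub>M\<^esub> linear_ext R M \<phi> f"
    if r: "r \<in> carrier R" and f: "f \<in> carrier ?F" for r f
  proof -
    have \<phi>: "\<phi> x \<in> carrier M" if "x \<in> ?s f" for x using fin(2)[OF f] that assms by blast
    have "linear_ext R M \<phi> (r \<odot>\<^bsub>?F\<^esub> f) = (\<Oplus>\<^bsub>M\<^esub>x\<in>?s f. (r \<otimes> f x) \<odot>\<^bsub>M\<^esub> \<phi> x)"
      using linear_ext_eq[OF assms F.smult_closed[OF r f] fin(1,2)[OF f]] r by (force simp: free_module_sel)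
    also have "\<dots> = (\<Oplus>\<^bsub>M\<^esub>x\<in>?s f. r \<odot>\<^bsub>M\<^esub> (f x \<odot>\<^bsub>M\<^esub> \<phi> x))"
      using fin(3)[OF f] \<phi> r by (intro M.finsum_cong') (auto simp: smult_assoc1)
    also have "\<dots> = r \<odot>\<^bsub>M\<^esub> (\<Oplus>\<^bsub>M\<^esub>x\<in>?s f. f x \<odot>\<^bsub>M\<^esub> \<phi> x)"
      using fin[OF f] \<phi> r by (intro finsum_smult_ldistr[symmetric]) auto
    finally show ?thesis by (simp add: linear_ext_def)
  qed
qed

lemma (in module) linear_ext_gen:
  assumes "\<phi> \<in> X \<rightarrow> carrier M" "x \<in> X"
  shows "linear_ext R M \<phi> (free_gen R x) = \<phi> x"
proof -
  have "linear_ext R M \<phi> (free_gen R x) = (\<Oplus>\<^bsub>M\<^esub>y\<in>{x}. free_gen R x y \<odot>\<^bsub>M\<^esub> \<phi> y)"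
    using assms by (intro linear_ext_eq[OF _ free_gen_carrier])
      (auto simp: free_gen_def R.is_cring)
  also have "\<dots> = \<phi> x"
    using assms by (simp add: free_gen_def M.finsum_insert Pi_iff)
  finally show ?thesis .
qed

text \<open>Induction on a finite set containing the support of \<open>f\<close>: erase one
  coefficient, then restore it as a multiple of a generator. Applied with \<open>N\<close> a kernel,
  it reduces the vanishing of a linear map to generators.\<close>

lemma free_module_memI:
  assumes "cring R" "f \<in> carrier (free_module R X)"
    and gen: "\<And>x. x \<in> X \<Longrightarrow> free_gen R x \<in> N"
    and N: "submodule N R (free_module R X)"
  shows "f \<in> N"
proof -
  interpret F: module R "free_module R X" by (rule free_module_module) fact
  have "f \<in> N" if "finite A" "f \<in> carrier (free_module R X)" "{x. f x \<noteq> \<zero>\<^bsub>R\<^esub>} \<subseteq> A" for A f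
    using that
  proof (induction A arbitrary: f rule: finite_induct)
    case empty
    then have "f = \<zero>\<^bsub>free_module R X\<^esub>" by (auto simp: free_module_sel)
    then show ?case using F.submodule_zero[OF N] by simp
  next
    case (insert x A)
    let ?g = "f(x := \<zero>\<^bsub>R\<^esub>)"
    have *: "{y. ?g y \<noteq> \<zero>\<^bsub>R\<^esub>} \<subseteq> {y. f y \<noteq> \<zero>\<^bsub>R\<^esub>}" by auto
    then have "?g \<in> carrier (free_module R X)"
      using insert.prems(1) finite_subset[OF *] by (auto simp: free_module_carrier_iff split: if_splits)
    moreover have "{y. ?g y \<noteq> \<zero>\<^bsub>R\<^esub>} \<subseteq> A" using insert.prems(2) by auto
    ultimately have g: "?g \<in> N" by (rule insert.IH)
    have fx: "f y \<in> carrier R" for y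
      using insert.prems(1) by (auto simp: free_module_carrier_iff)
    show ?case
    proof (cases "x \<in> X")
      case True
      have "f = ?g \<oplus>\<^bsub>free_module R X\<^esub> f x \<odot>\<^bsub>free_module R X\<^esub> free_gen R x"
        using fx by (auto simp: free_module_sel free_gen_def fun_eq_iff)
      then show ?thesis
        using g gen[OF True] fx F.submoduleE(4,5)[OF N] by metis
    next
      case False
      \<comment> \<open>Outside \<open>X\<close> the coefficient is already zero, so nothing was
        erased.\<close>
      then have "?g = f" using insert.prems(1) by (force simp: free_module_carrier_iff fun_eq_iff)
      then show ?thesis using g by simp
    qed
  qed
  then show ?thesis using assms(2) by (auto simp: free_module_carrier_iff)
qed

section \<open>Multilinear maps and powers of a module\<close>

text \<open>The varying slot is marked by splitting the tuple as \<open>us @ x # vs\<close>, exactly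
  as in \<open>multilinear_rels\<close>, so that each clause says that \<open>\<phi>\<close>
  respects one family of relations.\<close>

definition multilinear ::
    "('a, 'm) ring_scheme \<Rightarrow> ('a, 'b, 'n) module_scheme \<Rightarrow> ('a, 'c, 'p) module_scheme \<Rightarrow> nat \<Rightarrow>
       ('b list \<Rightarrow> 'c) \<Rightarrow> bool" where
  "multilinear R M P n \<phi> \<longleftrightarrow> \<phi> \<in> tuples M n \<rightarrow> carrier P \<and>
     (\<forall>us vs x y. us @ x # vs \<in> tuples M n \<longrightarrow> us @ y # vs \<in> tuples M n \<longrightarrow>
        \<phi> (us @ (x \<oplus>\<^bsub>M\<^esub> y) # vs) = \<phi> (us @ x # vs) \<oplus>\<^bsub>P\<^esub> \<phi> (us @ y # vs)) \<and>
     (\<forall>us vs r x. r \<in> carrier R \<longrightarrow> us @ x # vs \<in> tuples M n \<longrightarrow>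
        \<phi> (us @ (r \<odot>\<^bsub>M\<^esub> x) # vs) = r \<odot>\<^bsub>P\<^esub> \<phi> (us @ x # vs))"

lemma multilinearI:
  assumes "\<And>xs. xs \<in> tuples M n \<Longrightarrow> \<phi> xs \<in> carrier P"
    and "\<And>us vs x y. \<lbrakk>us @ x # vs \<in> tuples M n; us @ y # vs \<in> tuples M n\<rbrakk> \<Longrightarrow>
        \<phi> (us @ (x \<oplus>\<^bsub>M\<^esub> y) # vs) = \<phi> (us @ x # vs) \<oplus>\<^bsub>P\<^esub> \<phi> (us @ y # vs)"
    and "\<And>us vs r x. \<lbrakk>r \<in> carrier R; us @ x # vs \<in> tuples M n\<rbrakk> \<Longrightarrow>
        \<phi> (us @ (r \<odot>\<^bsub>M\<^esub> x) # vs) = r \<odot>\<^bsub>P\<^esub> \<phi> (us @ x # vs)"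
  shows "multilinear R M P n \<phi>"
  using assms by (simp add: multilinear_def)

lemma multilinearD:
  assumes "multilinear R M P n \<phi>"
  shows "xs \<in> tuples M n \<Longrightarrow> \<phi> xs \<in> carrier P"
    and "\<lbrakk>us @ x # vs \<in> tuples M n; us @ y # vs \<in> tuples M n\<rbrakk> \<Longrightarrow>
        \<phi> (us @ (x \<oplus>\<^bsub>M\<^esub> y) # vs) = \<phi> (us @ x # vs) \<oplus>\<^bsub>P\<^esub> \<phi> (us @ y # vs)"
    and "\<lbrakk>r \<in> carrier R; us @ x # vs \<in> tuples M n\<rbrakk> \<Longrightarrow>
        \<phi> (us @ (r \<odot>\<^bsub>M\<^esub> x) # vs) = r \<odot>\<^bsub>P\<^esub> \<phi> (us @ x # vs)"
  using assms by (auto simp: multilinear_def)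

lemma tuples_middle_iff:
  "us @ x # vs \<in> tuples M n \<longleftrightarrow>
     Suc (length us + length vs) = n \<and> x \<in> carrier M \<and> set us \<subseteq> carrier M \<and> set vs \<subseteq> carrier M"
  by (auto simp: tuples_def)

lemma (in module) tuples_add:
  "\<lbrakk>us @ x # vs \<in> tuples M n; us @ y # vs \<in> tuples M n\<rbrakk> \<Longrightarrow> us @ (x \<oplus>\<^bsub>M\<^esub> y) # vs \<in> tuples M n"
  by (auto simp: tuples_middle_iff)

lemma (in module) tuples_smult:
  "\<lbrakk>r \<in> carrier R; us @ x # vs \<in> tuples M n\<rbrakk> \<Longrightarrow> us @ (r \<odot>\<^bsub>M\<^esub> x) # vs \<in> tuples M n"
  by (auto simp: tuples_middle_iff)

lemma multilinear_finsum:
  assumes "module R M" "module R P" "finite A" "\<And>a. a \<in> A \<Longrightarrow> multilinear R M P n (\<phi> a)"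
  shows "multilinear R M P n (\<lambda>xs. \<Oplus>\<^bsub>P\<^esub>a\<in>A. \<phi> a xs)"
proof -
  interpret M: module R M by fact
  interpret P: module R P by fact
  note D = multilinearD[OF assms(4)]
  show ?thesis
  proof (rule multilinearI)
    fix us vs x y assume *: "us @ x # vs \<in> tuples M n" "us @ y # vs \<in> tuples M n"
    then have "us @ (x \<oplus>\<^bsub>M\<^esub> y) # vs \<in> tuples M n" by (rule M.tuples_add)
    then have "(\<Oplus>\<^bsub>P\<^esub>a\<in>A. \<phi> a (us @ (x \<oplus>\<^bsub>M\<^esub> y) # vs)) =
        (\<Oplus>\<^bsub>P\<^esub>a\<in>A. \<phi> a (us @ x # vs) \<oplus>\<^bsub>P\<^esub> \<phi> a (us @ y # vs))"
      using * D by (intro P.finsum_cong') auto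
    also have "\<dots> = (\<Oplus>\<^bsub>P\<^esub>a\<in>A. \<phi> a (us @ x # vs)) \<oplus>\<^bsub>P\<^esub> (\<Oplus>\<^bsub>P\<^esub>a\<in>A. \<phi> a (us @ y # vs))"
      using * D by (intro P.finsum_addf) auto
    finally show "(\<Oplus>\<^bsub>P\<^esub>a\<in>A. \<phi> a (us @ (x \<oplus>\<^bsub>M\<^esub> y) # vs)) = \<dots>" .
  next
    fix us vs r x assume *: "r \<in> carrier R" "us @ x # vs \<in> tuples M n"
    then have "us @ (r \<odot>\<^bsub>M\<^esub> x) # vs \<in> tuples M n" by (rule M.tuples_smult)
    then have "(\<Oplus>\<^bsub>P\<^esub>a\<in>A. \<phi> a (us @ (r \<odot>\<^bsub>M\<^esub> x) # vs)) = (\<Oplus>\<^bsub>P\<^esub>a\<in>A. r \<odot>\<^bsub>P\<^esub> \<phi> a (us @ x # vs))"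
      using * D by (intro P.finsum_cong') auto
    also have "\<dots> = r \<odot>\<^bsub>P\<^esub> (\<Oplus>\<^bsub>P\<^esub>a\<in>A. \<phi> a (us @ x # vs))"
      using * D assms(3) by (intro P.finsum_smult_ldistr[symmetric]) auto
    finally show "(\<Oplus>\<^bsub>P\<^esub>a\<in>A. \<phi> a (us @ (r \<odot>\<^bsub>M\<^esub> x) # vs)) = \<dots>" .
  qed (use D in \<open>auto intro!: P.finsum_closed\<close>)
qed

lemma linear_map_multilinear:
  assumes "linear_map R P Q f" "multilinear R M P n \<phi>"
  shows "multilinear R M Q n (\<lambda>xs. f (\<phi> xs))"
proof -
  interpret f: linear_map R P Q f by fact
  show ?thesis
    by (rule multilinearI)
      (use multilinearD[OF assms(2)] in \<open>auto simp: f.map_add f.map_smult\<close>)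
qed

lemma (in module) smult_linear:
  assumes "r \<in> carrier R" shows "linear_map R M M (\<lambda>x. r \<odot>\<^bsub>M\<^esub> x)"
  by (intro linear_map.intro linear_map_axioms.intro module_axioms)
    (use assms in \<open>auto simp: smult_r_distr smult_assoc1[symmetric] R.m_comm\<close>)

section \<open>Multilinearity for two and three arguments\<close>

lemma tuples_Suc_conv:
  "xs \<in> tuples M (Suc n) \<longleftrightarrow> (\<exists>x ys. xs = x # ys \<and> x \<in> carrier M \<and> ys \<in> tuples M n)"
  "xs \<in> tuples M 0 \<longleftrightarrow> xs = []"
  by (auto simp: tuples_def length_Suc_conv)

lemma multilinear2I:
  assumes c: "\<And>x y. \<lbrakk>x \<in> carrier M; y \<in> carrier M\<rbrakk> \<Longrightarrow> g x y \<in> carrier P"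
    and a: "\<And>x x' y. \<lbrakk>x \<in> carrier M; x' \<in> carrier M; y \<in> carrier M\<rbrakk> \<Longrightarrow>
        g (x \<oplus>\<^bsub>M\<^esub> x') y = g x y \<oplus>\<^bsub>P\<^esub> g x' y"
      "\<And>x y y'. \<lbrakk>x \<in> carrier M; y \<in> carrier M; y' \<in> carrier M\<rbrakk> \<Longrightarrow>
        g x (y \<oplus>\<^bsub>M\<^esub> y') = g x y \<oplus>\<^bsub>P\<^esub> g x y'"
    and s: "\<And>r x y. \<lbrakk>r \<in> carrier R; x \<in> carrier M; y \<in> carrier M\<rbrakk> \<Longrightarrow>
        g (r \<odot>\<^bsub>M\<^esub> x) y = r \<odot>\<^bsub>P\<^esub> g x y"
      "\<And>r x y. \<lbrakk>r \<in> carrier R; x \<in> carrier M; y \<in> carrier M\<rbrakk> \<Longrightarrow>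
        g x (r \<odot>\<^bsub>M\<^esub> y) = r \<odot>\<^bsub>P\<^esub> g x y"
  shows "multilinear R M P 2 (\<lambda>xs. g (xs ! 0) (xs ! 1))"
proof (rule multilinearI)
  fix xs assume "xs \<in> tuples M 2"
  then show "g (xs ! 0) (xs ! 1) \<in> carrier P"
    using c by (auto simp: numeral_2_eq_2 tuples_Suc_conv)
next
  fix us vs x y assume "us @ x # vs \<in> tuples M 2" "us @ y # vs \<in> tuples M 2"
  then show "g ((us @ (x \<oplus>\<^bsub>M\<^esub> y) # vs) ! 0) ((us @ (x \<oplus>\<^bsub>M\<^esub> y) # vs) ! 1) =
      g ((us @ x # vs) ! 0) ((us @ x # vs) ! 1) \<oplus>\<^bsub>P\<^esub> g ((us @ y # vs) ! 0) ((us @ y # vs) ! 1)"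
    using a by (auto simp: numeral_2_eq_2 tuples_Suc_conv append_eq_Cons_conv Cons_eq_append_conv)
next
  fix us vs r x assume "r \<in> carrier R" "us @ x # vs \<in> tuples M 2"
  then show "g ((us @ (r \<odot>\<^bsub>M\<^esub> x) # vs) ! 0) ((us @ (r \<odot>\<^bsub>M\<^esub> x) # vs) ! 1) =
      r \<odot>\<^bsub>P\<^esub> g ((us @ x # vs) ! 0) ((us @ x # vs) ! 1)"
    using s by (auto simp: numeral_2_eq_2 tuples_Suc_conv append_eq_Cons_conv Cons_eq_append_conv)
qed

lemma multilinear3I:
  assumes c: "\<And>x y z. \<lbrakk>x \<in> carrier M; y \<in> carrier M; z \<in> carrier M\<rbrakk> \<Longrightarrow> g x y z \<in> carrier P"
    and a: "\<And>x x' y z. \<lbrakk>x \<in> carrier M; x' \<in> carrier M; y \<in> carrier M; z \<in> carrier M\<rbrakk> \<Longrightarrow>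
        g (x \<oplus>\<^bsub>M\<^esub> x') y z = g x y z \<oplus>\<^bsub>P\<^esub> g x' y z"
      "\<And>x y y' z. \<lbrakk>x \<in> carrier M; y \<in> carrier M; y' \<in> carrier M; z \<in> carrier M\<rbrakk> \<Longrightarrow>
        g x (y \<oplus>\<^bsub>M\<^esub> y') z = g x y z \<oplus>\<^bsub>P\<^esub> g x y' z"
      "\<And>x y z z'. \<lbrakk>x \<in> carrier M; y \<in> carrier M; z \<in> carrier M; z' \<in> carrier M\<rbrakk> \<Longrightarrow>
        g x y (z \<oplus>\<^bsub>M\<^esub> z') = g x y z \<oplus>\<^bsub>P\<^esub> g x y z'"
    and s: "\<And>r x y z. \<lbrakk>r \<in> carrier R; x \<in> carrier M; y \<in> carrier M; z \<in> carrier M\<rbrakk> \<Longrightarrow>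
        g (r \<odot>\<^bsub>M\<^esub> x) y z = r \<odot>\<^bsub>P\<^esub> g x y z"
      "\<And>r x y z. \<lbrakk>r \<in> carrier R; x \<in> carrier M; y \<in> carrier M; z \<in> carrier M\<rbrakk> \<Longrightarrow>
        g x (r \<odot>\<^bsub>M\<^esub> y) z = r \<odot>\<^bsub>P\<^esub> g x y z"
      "\<And>r x y z. \<lbrakk>r \<in> carrier R; x \<in> carrier M; y \<in> carrier M; z \<in> carrier M\<rbrakk> \<Longrightarrow>
        g x y (r \<odot>\<^bsub>M\<^esub> z) = r \<odot>\<^bsub>P\<^esub> g x y z"
  shows "multilinear R M P 3 (\<lambda>xs. g (xs ! 0) (xs ! 1) (xs ! 2))"
proof (rule multilinearI)
  fix xs assume "xs \<in> tuples M 3"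
  then show "g (xs ! 0) (xs ! 1) (xs ! 2) \<in> carrier P"
    using c by (auto simp: numeral_3_eq_3 tuples_Suc_conv)
next
  fix us vs x y assume "us @ x # vs \<in> tuples M 3" "us @ y # vs \<in> tuples M 3"
  then show "g ((us @ (x \<oplus>\<^bsub>M\<^esub> y) # vs) ! 0) ((us @ (x \<oplus>\<^bsub>M\<^esub> y) # vs) ! 1) ((us @ (x \<oplus>\<^bsub>M\<^esub> y) # vs) ! 2) =
      g ((us @ x # vs) ! 0) ((us @ x # vs) ! 1) ((us @ x # vs) ! 2) \<oplus>\<^bsub>P\<^esub>
      g ((us @ y # vs) ! 0) ((us @ y # vs) ! 1) ((us @ y # vs) ! 2)"
    using a by (auto simp: numeral_3_eq_3 tuples_Suc_conv append_eq_Cons_conv Cons_eq_append_conv)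
next
  fix us vs r x assume "r \<in> carrier R" "us @ x # vs \<in> tuples M 3"
  then show "g ((us @ (r \<odot>\<^bsub>M\<^esub> x) # vs) ! 0) ((us @ (r \<odot>\<^bsub>M\<^esub> x) # vs) ! 1) ((us @ (r \<odot>\<^bsub>M\<^esub> x) # vs) ! 2) =
      r \<odot>\<^bsub>P\<^esub> g ((us @ x # vs) ! 0) ((us @ x # vs) ! 1) ((us @ x # vs) ! 2)"
    using s by (auto simp: numeral_3_eq_3 tuples_Suc_conv append_eq_Cons_conv Cons_eq_append_conv)
qed

text \<open>Tensor, exterior and symmetric powers differ only in the relations \<open>S\<close>
  added to multilinearity, so the presentation is studied once with \<open>S\<close> as a parameter;
  \<open>S = {}\<close> gives the tensor power.\<close>

locale power_module = module R M
  for R :: "('a, 'm) ring_scheme" (structure) and M :: "('a, 'b, 'n) module_scheme" (structure) +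
  fixes n :: nat and S :: "('b list \<Rightarrow> 'a) set"
  assumes relations_carrier: "S \<subseteq> carrier (free_module R (tuples M n))"
begin

abbreviation F where "F \<equiv> free_module R (tuples M n)"
abbreviation N where "N \<equiv> power_rel R M n S"
abbreviation T where "T \<equiv> quot_module F N"
abbreviation gen_class where "gen_class xs \<equiv> N +>\<^bsub>F\<^esub> free_gen R xs"

sublocale F: module R F
  by (rule free_module_module) (rule R.is_cring)

lemma gen_carrier: "xs \<in> tuples M n \<Longrightarrow> free_gen R xs \<in> carrier F"
  by (rule free_gen_carrier) (rule R.is_cring)

lemma multilinear_rels_carrier: "multilinear_rels R M n \<subseteq> carrier F"
  unfolding multilinear_rels_def Let_def
  using tuples_add tuples_smult gen_carrier
  by (blast intro!: F.M.minus_closed F.M.a_closed F.smult_closed gen_carrier)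

lemma power_rel_submodule: "submodule N R F"
  unfolding power_rel_def
  using multilinear_rels_carrier relations_carrier by (intro F.submodule_span_submodule) simp

sublocale T: quotient_module R F N
  by (intro quotient_module.intro F.module_axioms power_rel_submodule)

lemma rel_mem: "s \<in> multilinear_rels R M n \<union> S \<Longrightarrow> s \<in> N"
  unfolding power_rel_def using F.submodule_span_incl by blast

lemma add_rel:
  assumes "us @ x # vs \<in> tuples M n" "us @ y # vs \<in> tuples M n"
  shows "free_gen R (us @ (x \<oplus>\<^bsub>M\<^esub> y) # vs) \<ominus>\<^bsub>F\<^esub> (free_gen R (us @ x # vs) \<oplus>\<^bsub>F\<^esub> free_gen R (us @ y # vs))
    \<in> multilinear_rels R M n \<union> S"
  unfolding multilinear_rels_def Let_def
  by (rule UnI1, rule UnI1, rule CollectI, intro exI conjI) (rule refl assms)+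

lemma smult_rel:
  assumes "r \<in> carrier R" "us @ x # vs \<in> tuples M n"
  shows "free_gen R (us @ (r \<odot>\<^bsub>M\<^esub> x) # vs) \<ominus>\<^bsub>F\<^esub> r \<odot>\<^bsub>F\<^esub> free_gen R (us @ x # vs)
    \<in> multilinear_rels R M n \<union> S"
  unfolding multilinear_rels_def Let_def
  by (rule UnI1, rule UnI2, rule CollectI, intro exI conjI) (rule refl assms)+

lemma gen_class_multilinear: "multilinear R M T n gen_class"
proof -
  interpret \<pi>: linear_map R F T "\<lambda>x. N +>\<^bsub>F\<^esub> x" by (rule T.coset_linear)
  show ?thesis
  proof (rule multilinearI)
    fix us vs x y assume *: "us @ x # vs \<in> tuples M n" "us @ y # vs \<in> tuples M n"
    then have **: "us @ (x \<oplus>\<^bsub>M\<^esub> y) # vs \<in> tuples M n" by (simp add: tuples_add tuples_smult)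
    have "gen_class (us @ (x \<oplus>\<^bsub>M\<^esub> y) # vs) =
        N +>\<^bsub>F\<^esub> (free_gen R (us @ x # vs) \<oplus>\<^bsub>F\<^esub> free_gen R (us @ y # vs))"
      using * ** by (intro T.coset_eqI gen_carrier F.M.a_closed rel_mem add_rel)
    then show "gen_class (us @ (x \<oplus>\<^bsub>M\<^esub> y) # vs) = gen_class (us @ x # vs) \<oplus>\<^bsub>T\<^esub> gen_class (us @ y # vs)"
      using * by (simp add: gen_carrier \<pi>.map_add)
  next
    fix us vs r x assume *: "r \<in> carrier R" "us @ x # vs \<in> tuples M n"
    then have **: "us @ (r \<odot>\<^bsub>M\<^esub> x) # vs \<in> tuples M n" by (simp add: tuples_add tuples_smult)
    have "gen_class (us @ (r \<odot>\<^bsub>M\<^esub> x) # vs) = N +>\<^bsub>F\<^esub> (r \<odot>\<^bsub>F\<^esub> free_gen R (us @ x # vs))"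
      using * ** by (intro T.coset_eqI gen_carrier F.smult_closed rel_mem smult_rel)
    then show "gen_class (us @ (r \<odot>\<^bsub>M\<^esub> x) # vs) = r \<odot>\<^bsub>T\<^esub> gen_class (us @ x # vs)"
      using * by (simp add: gen_carrier \<pi>.map_smult)
  qed (auto simp: gen_carrier)
qed

text \<open>The kernel of the linear extension is a submodule. Multilinearity of
  \<open>\<phi>\<close> puts the first family of relations into it and the premise on
  \<open>S\<close> the second, hence it contains the span of both.\<close>

lemma universal_property:
  assumes P: "module R P" and \<phi>: "multilinear R M P n \<phi>"
    and S: "\<And>s. s \<in> S \<Longrightarrow> linear_ext R P \<phi> s = \<zero>\<^bsub>P\<^esub>"
  shows "linear_map R T P (quot_map (linear_ext R P \<phi>))"
    and "xs \<in> tuples M n \<Longrightarrow> quot_map (linear_ext R P \<phi>) (gen_class xs) = \<phi> xs"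
proof -
  interpret P: module R P by fact
  have \<phi>': "\<phi> \<in> tuples M n \<rightarrow> carrier P" using \<phi> by (simp add: multilinear_def)
  interpret f: linear_map R F P "linear_ext R P \<phi>" by (rule P.linear_ext_linear) fact
  note gen = P.linear_ext_gen[OF \<phi>']
  have "linear_ext R P \<phi> s = \<zero>\<^bsub>P\<^esub>" if "s \<in> multilinear_rels R M n" for s
  proof -
    show ?thesis
      using that unfolding multilinear_rels_def Let_def
    proof (elim UnE CollectE exE conjE)
      fix us vs x y
      assume *: "us @ x # vs \<in> tuples M n" "us @ y # vs \<in> tuples M n"
        and s: "s = free_gen R (us @ (x \<oplus>\<^bsub>M\<^esub> y) # vs) \<ominus>\<^bsub>F\<^esub> (free_gen R (us @ x # vs) \<oplus>\<^bsub>F\<^esub> free_gen R (us @ y # vs))"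
      show ?thesis using * tuples_add[OF *] multilinearD[OF \<phi>]
        by (simp add: s f.map_diff f.map_add gen gen_carrier P.M.minus_eq P.M.r_neg)
    next
      fix us vs r x
      assume *: "us @ x # vs \<in> tuples M n" "r \<in> carrier R"
        and s: "s = free_gen R (us @ (r \<odot>\<^bsub>M\<^esub> x) # vs) \<ominus>\<^bsub>F\<^esub> r \<odot>\<^bsub>F\<^esub> free_gen R (us @ x # vs)"
      show ?thesis using * tuples_smult[OF *(2,1)] multilinearD[OF \<phi>]
        by (simp add: s f.map_diff f.map_smult gen gen_carrier P.M.minus_eq P.M.r_neg)
    qed
  qed
  then have "N \<subseteq> {x \<in> carrier F. linear_ext R P \<phi> x = \<zero>\<^bsub>P\<^esub>}"
    unfolding power_rel_def using S multilinear_rels_carrier relations_carrier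
    by (intro F.submodule_span_least f.kernel_submodule) blast
  then have *: "linear_ext R P \<phi> x = \<zero>\<^bsub>P\<^esub>" if "x \<in> N" for x using that by blast
  show "linear_map R T P (quot_map (linear_ext R P \<phi>))"
    by (rule T.quot_map_linear[OF f.linear_map_axioms *])
  show "quot_map (linear_ext R P \<phi>) (gen_class xs) = \<phi> xs" if "xs \<in> tuples M n"
    using T.quot_map_coset[OF f.linear_map_axioms * gen_carrier[OF that]] gen[OF that] by simp
qed

text \<open>Pulled back to the free module, the map has a kernel that contains every generator,
  hence everything.\<close>

lemma linear_map_zeroI:
  assumes "linear_map R T P g" "\<And>xs. xs \<in> tuples M n \<Longrightarrow> g (gen_class xs) = \<zero>\<^bsub>P\<^esub>" "x \<in> carrier T"
  shows "g x = \<zero>\<^bsub>P\<^esub>"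
proof -
  interpret f: linear_map R F P "\<lambda>y. g (N +>\<^bsub>F\<^esub> y)"
    by (rule linear_map_comp[OF T.coset_linear assms(1)])
  obtain y where y: "y \<in> carrier F" "x = N +>\<^bsub>F\<^esub> y" using assms(3) T.quot_carrier by blast
  have "y \<in> {y \<in> carrier F. g (N +>\<^bsub>F\<^esub> y) = \<zero>\<^bsub>P\<^esub>}"
    by (rule free_module_memI[OF R.is_cring y(1) _ f.kernel_submodule])
      (simp add: gen_carrier assms(2))
  then show ?thesis using y by simp
qed

end

section \<open>The three powers as instances; exterior powers\<close>

context module
begin

lemma power_module_ext: "power_module R M n (alternating_rels R M n)"
  by (intro power_module.intro module_axioms power_module_axioms.intro)
    (auto simp: alternating_rels_def free_gen_carrier R.is_cring)

lemma power_module_sym: "power_module R M n (symmetric_rels R M n)"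
proof -
  interpret F: module R "free_module R (tuples M n)" by (rule free_module_module[OF R.is_cring])
  \<comment> \<open>\<open>symmetric_rels\<close> asks only \<open>xs\<close> to be a tuple; a
    rearrangement has the same length and the same entries.\<close>
  have t: "ys \<in> tuples M n" if "xs \<in> tuples M n" "mset ys = mset xs" for xs ys
    using that mset_eq_setD[OF that(2)] mset_eq_length[OF that(2)] by (auto simp: tuples_def)
  show ?thesis
    by (intro power_module.intro module_axioms power_module_axioms.intro)
      (auto simp: symmetric_rels_def intro!: F.M.minus_closed free_gen_carrier[OF R.is_cring] dest: t)
qed

lemma power_module_tensor: "power_module R M n {}"
  by (intro power_module.intro module_axioms power_module_axioms.intro) simp

lemma ext_power_module: "module R (ext_power R M n)"
proof -
  interpret power_module R M n "alternating_rels R M n" by (rule power_module_ext)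
  show ?thesis unfolding ext_power_def by (rule T.quot_module)
qed

lemma wedge_multilinear: "multilinear R M (ext_power R M n) n (wedge R M)"
proof -
  interpret power_module R M n "alternating_rels R M n" by (rule power_module_ext)
  \<comment> \<open>\<open>wedge\<close> takes its degree from the length of the list, so it agrees
    with \<open>gen_class\<close> on tuples of length \<open>n\<close>.\<close>
  have *: "wedge R M xs = gen_class xs" if "xs \<in> tuples M n" for xs
    using that by (simp add: wedge_def tuples_def Let_def)
  show ?thesis unfolding ext_power_def
    by (rule multilinearI) (simp_all add: * multilinearD[OF gen_class_multilinear] tuples_add tuples_smult)
qed

lemma wedge_alternating:
  assumes "xs \<in> tuples M n" "\<not> distinct xs" shows "wedge R M xs = \<zero>\<^bsub>ext_power R M n\<^esub>"
proof -
  interpret power_module R M n "alternating_rels R M n" by (rule power_module_ext)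
  have "free_gen R xs \<in> N" using assms by (intro rel_mem) (auto simp: alternating_rels_def)
  moreover have "wedge R M xs = gen_class xs"
    using assms(1) by (simp add: wedge_def tuples_def Let_def)
  ultimately show ?thesis
    unfolding ext_power_def using T.coset_eq_zero_iff[OF gen_carrier[OF assms(1)]] by simp
qed

lemma ext_power_universal:
  assumes "module R P" "multilinear R M P n \<phi>"
    and alt: "\<And>xs. \<lbrakk>xs \<in> tuples M n; \<not> distinct xs\<rbrakk> \<Longrightarrow> \<phi> xs = \<zero>\<^bsub>P\<^esub>"
  shows "linear_map R (ext_power R M n) P (quot_map (linear_ext R P \<phi>))"
    and "xs \<in> tuples M n \<Longrightarrow> quot_map (linear_ext R P \<phi>) (wedge R M xs) = \<phi> xs"
proof -
  interpret P: module R P by fact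
  interpret power_module R M n "alternating_rels R M n" by (rule power_module_ext)
  have "linear_ext R P \<phi> s = \<zero>\<^bsub>P\<^esub>" if s: "s \<in> alternating_rels R M n" for s
    using s assms(2) P.linear_ext_gen[of \<phi> "tuples M n"] alt
    by (auto simp: alternating_rels_def multilinear_def)
  note * = universal_property[OF assms(1,2) this]
  show "linear_map R (ext_power R M n) P (quot_map (linear_ext R P \<phi>))"
    unfolding ext_power_def by (rule *(1))
  show "quot_map (linear_ext R P \<phi>) (wedge R M xs) = \<phi> xs" if "xs \<in> tuples M n"
    using *(2)[OF _ that] that by (simp add: wedge_def tuples_def Let_def)
qed

lemma ext_power_zeroI:
  assumes "linear_map R (ext_power R M n) P g"
    "\<And>xs. xs \<in> tuples M n \<Longrightarrow> g (wedge R M xs) = \<zero>\<^bsub>P\<^esub>" "x \<in> carrier (ext_power R M n)"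
  shows "g x = \<zero>\<^bsub>P\<^esub>"
proof -
  interpret power_module R M n "alternating_rels R M n" by (rule power_module_ext)
  have "g (gen_class xs) = \<zero>\<^bsub>P\<^esub>" if "xs \<in> tuples M n" for xs
    using assms(2)[OF that] that by (simp add: wedge_def tuples_def Let_def)
  then show ?thesis using assms(1,3) linear_map_zeroI unfolding ext_power_def by blast
qed

lemma multilinear_minus:
  assumes "module R P" "multilinear R M P n \<phi>" "us @ x # vs \<in> tuples M n"
  shows "\<phi> (us @ (\<ominus>\<^bsub>M\<^esub> x) # vs) = \<ominus>\<^bsub>P\<^esub> \<phi> (us @ x # vs)"
proof -
  interpret P: module R P by fact
  have x: "x \<in> carrier M" using assms(3) by (simp add: tuples_middle_iff)
  have "\<ominus>\<^bsub>M\<^esub> x = (\<ominus> \<one>) \<odot>\<^bsub>M\<^esub> x" using x by (simp add: smult_l_minus)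
  then show ?thesis
    using multilinearD(1,3)[OF assms(2)] assms(3) by (simp add: P.smult_l_minus)
qed

lemma multilinear_zero:
  assumes "module R P" "multilinear R M P n \<phi>" "us @ \<zero>\<^bsub>M\<^esub> # vs \<in> tuples M n"
  shows "\<phi> (us @ \<zero>\<^bsub>M\<^esub> # vs) = \<zero>\<^bsub>P\<^esub>"
proof -
  interpret P: module R P by fact
  show ?thesis
    using multilinearD(1)[OF assms(2,3)]
      multilinearD(3)[OF assms(2) R.zero_closed assms(3)] assms(3) by simp
qed

text \<open>Polarisation: expand the value at a tuple with \<open>x \<oplus> y\<close> in two
  adjacent slots. It vanishes, as do the two terms with a repeated entry, which leaves the sum of
  the two mixed terms. The exterior power is presented by vanishing on repetitions, so the sign rule
  has to be derived.\<close>

lemma alternating_swap: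
  assumes "module R P" "multilinear R M P n \<phi>"
    and alt: "\<And>xs. \<lbrakk>xs \<in> tuples M n; \<not> distinct xs\<rbrakk> \<Longrightarrow> \<phi> xs = \<zero>\<^bsub>P\<^esub>"
    and xy: "us @ x # y # vs \<in> tuples M n"
  shows "\<phi> (us @ y # x # vs) = \<ominus>\<^bsub>P\<^esub> \<phi> (us @ x # y # vs)"
proof -
  interpret P: module R P by fact
  have t: "us @ u # v # vs \<in> tuples M n" if "u \<in> carrier M" "v \<in> carrier M" for u v
    using xy that by (simp add: tuples_def)
  have c: "x \<in> carrier M" "y \<in> carrier M" using xy by (auto simp: tuples_def)
  have l: "\<phi> (us @ (u \<oplus>\<^bsub>M\<^esub> u') # v # vs) = \<phi> (us @ u # v # vs) \<oplus>\<^bsub>P\<^esub> \<phi> (us @ u' # v # vs)"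
    and r: "\<phi> (us @ v # (u \<oplus>\<^bsub>M\<^esub> u') # vs) = \<phi> (us @ v # u # vs) \<oplus>\<^bsub>P\<^esub> \<phi> (us @ v # u' # vs)"
    if "u \<in> carrier M" "u' \<in> carrier M" "v \<in> carrier M" for u u' v
    using multilinearD(2)[OF assms(2), of us u "v # vs" u'] multilinearD(2)[OF assms(2), of "us @ [v]" u vs u']
      t that by simp_all
  have z: "\<phi> (us @ u # u # vs) = \<zero>\<^bsub>P\<^esub>" if "u \<in> carrier M" for u
    using alt[OF t] that by simp
  have p: "\<phi> (us @ u # v # vs) \<in> carrier P" if "u \<in> carrier M" "v \<in> carrier M" for u v
    using multilinearD(1)[OF assms(2) t] that .
  have "\<phi> (us @ y # x # vs) \<oplus>\<^bsub>P\<^esub> \<phi> (us @ x # y # vs) = \<phi> (us @ (x \<oplus>\<^bsub>M\<^esub> y) # (x \<oplus>\<^bsub>M\<^esub> y) # vs)"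
    using c by (simp add: l r z[of x] z[of y] p P.M.a_comm)
  also have "\<dots> = \<zero>\<^bsub>P\<^esub>" using z c by simp
  finally show ?thesis using c p by (simp add: P.M.minus_equality)
qed

end

section \<open>The Chevalley--Eilenberg differential\<close>

text \<open>Pairs are listed by their larger index; this fixes the order of the terms in the
  explicit boundary formulas in degrees 3 and 4.\<close>

lemma (in abelian_group) finsum_pairs:
  assumes f: "\<And>i j :: nat. \<lbrakk>i < j; j < n\<rbrakk> \<Longrightarrow> f i j \<in> carrier G"
  shows "n = 3 \<Longrightarrow> (\<Oplus>\<^bsub>G\<^esub>j\<in>{..<n}. \<Oplus>\<^bsub>G\<^esub>i\<in>{..<j}. f i j) = f 0 1 \<oplus> (f 0 2 \<oplus> f 1 2)"
    and "n = 4 \<Longrightarrow> (\<Oplus>\<^bsub>G\<^esub>j\<in>{..<n}. \<Oplus>\<^bsub>G\<^esub>i\<in>{..<j}. f i j) =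
      f 0 1 \<oplus> (f 0 2 \<oplus> (f 1 2 \<oplus> (f 0 3 \<oplus> (f 1 3 \<oplus> f 2 3))))"
proof -
  have s: "{..<4::nat} = {0, 1, 2, 3}" "{..<3::nat} = {0, 1, 2}" "{..<2::nat} = {0, 1}" "{..<Suc 0} = {0}"
    by auto
  show "n = 3 \<Longrightarrow> (\<Oplus>\<^bsub>G\<^esub>j\<in>{..<n}. \<Oplus>\<^bsub>G\<^esub>i\<in>{..<j}. f i j) = f 0 1 \<oplus> (f 0 2 \<oplus> f 1 2)"
    using f by (simp add: s finsum_insert a_ac Pi_iff)
  show "n = 4 \<Longrightarrow> (\<Oplus>\<^bsub>G\<^esub>j\<in>{..<n}. \<Oplus>\<^bsub>G\<^esub>i\<in>{..<j}. f i j) =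
      f 0 1 \<oplus> (f 0 2 \<oplus> (f 1 2 \<oplus> (f 0 3 \<oplus> (f 1 3 \<oplus> f 2 3))))"
    using f by (simp add: s finsum_insert a_ac Pi_iff)
qed

context lie_algebra
begin

text \<open>Polarisation of \<open>bracket_self\<close> at \<open>x \<oplus> y\<close>.\<close>

lemma bracket_antisym:
  assumes "x \<in> carrier L" "y \<in> carrier L"
  shows "lie_bracket L y x = \<ominus>\<^bsub>L\<^esub> lie_bracket L x y"
proof -
  have "lie_bracket L y x \<oplus>\<^bsub>L\<^esub> lie_bracket L x y = lie_bracket L (x \<oplus>\<^bsub>L\<^esub> y) (x \<oplus>\<^bsub>L\<^esub> y)"
    using assms bracket_add_left bracket_add_right
    by (simp del: bracket_self add: bracket_self[of x] bracket_self[of y] bracket_closed M.a_comm)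
  also have "\<dots> = \<zero>\<^bsub>L\<^esub>" using assms by (simp add: bracket_self)
  finally show ?thesis using assms by (simp add: M.minus_equality bracket_closed)
qed

text \<open>Two entries leave and one bracket enters. Since \<open>i < j < n\<close> forces
  \<open>n \<ge> 2\<close>, the truncated differences satisfy (n - 2) + 1 = n - 1.\<close>

lemma bracket_term_tuples:
  assumes "xs \<in> tuples L n" "i < j" "j < n"
  shows "lie_bracket L (xs ! i) (xs ! j) # nths xs (- {i, j}) \<in> tuples L (n - 1)"
proof -
  have "{k. k < n \<and> k \<in> - {i, j}} = {..<n} - {i, j}" by auto
  then have "card {k. k < n \<and> k \<in> - {i, j}} = n - 2"
    using assms by (simp add: card_Diff_subset)
  moreover have "xs ! i \<in> carrier L" "xs ! j \<in> carrier L"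
    using assms by (auto simp: tuples_def)
  ultimately show ?thesis
    using assms set_nths_subset[of xs "- {i, j}"] by (auto simp: tuples_def length_nths bracket_closed)
qed

text \<open>Varying one slot of \<open>xs\<close> varies exactly one slot of the contracted tuple:
  either the same entry, moved to another place, or the bracket, in its left or right argument. In
  each case the new entry depends on the old one through a linear \<open>f\<close>, so
  multilinearity of \<open>\<psi>\<close> carries over.\<close>

lemma bracket_term_multilinear:
  assumes "multilinear R L P (n - 1) \<psi>" "i < j" "j < n"
  shows "multilinear R L P n (\<lambda>xs. \<psi> (lie_bracket L (xs ! i) (xs ! j) # nths xs (- {i, j})))"
    (is "multilinear R L P n ?\<phi>")
proof -
  have *: "(\<exists>us' vs' f. (f = (\<lambda>x. x) \<or> (\<exists>z \<in> carrier L. f = (\<lambda>x. lie_bracket L x z)) \<or>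
      (\<exists>z \<in> carrier L. f = (\<lambda>x. lie_bracket L z x))) \<and>
      (\<forall>x. lie_bracket L ((us @ x # vs) ! i) ((us @ x # vs) ! j) # nths (us @ x # vs) (- {i, j})
        = us' @ f x # vs'))"
    if t: "us @ x\<^sub>0 # vs \<in> tuples L n" for us x\<^sub>0 vs
  proof -
    have c: "set us \<subseteq> carrier L" "set vs \<subseteq> carrier L" "Suc (length us + length vs) = n"
      using t by (auto simp: tuples_middle_iff)
    let ?k = "length us" and ?A = "- {i, j}"
    \<comment> \<open>The positions of \<open>vs\<close> that survive, shifted by
      \<open>length us + 1\<close>, in the form in which \<open>nths_append\<close> and
      \<open>nths_Cons\<close> produce them.\<close>
    let ?B = "{l. Suc l \<in> {l. l + length us \<in> - {i, j}}}"
    have nths: "nths (us @ x # vs) ?A = nths us ?A @ (if ?k \<in> ?A then [x] else []) @ nths vs ?B" for x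
      by (simp add: nths_append nths_Cons)
    consider "?k = i" | "?k = j" | "?k \<noteq> i" "?k \<noteq> j" by blast
    then show ?thesis
    proof cases
      case 1
      \<comment> \<open>The varying slot sits at position \<open>i\<close>, so \<open>vs\<close>
        begins at position \<open>i + 1\<close> and entry \<open>j\<close> has index
        \<open>j - i - 1\<close> in \<open>vs\<close>.\<close>
      then have "(us @ x # vs) ! j = vs ! (j - i - 1)" "(us @ x # vs) ! i = x" for x
        using assms(2) by (auto simp: nth_append nth_Cons')
      moreover have "vs ! (j - i - 1) \<in> carrier L" using 1 c assms(2,3) by (auto intro!: subsetD[OF c(2)] nth_mem)
      ultimately show ?thesis using 1 nths
        by (intro exI[of _ "[]"] exI[of _ "nths us ?A @ nths vs ?B"]
            exI[of _ "\<lambda>x. lie_bracket L x (vs ! (j - i - 1))"]) auto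
    next
      case 2
      then have "(us @ x # vs) ! i = us ! i" "(us @ x # vs) ! j = x" for x
        using assms(2) by (auto simp: nth_append)
      moreover have "us ! i \<in> carrier L" using 2 c assms(2) by (auto intro!: subsetD[OF c(1)] nth_mem)
      ultimately show ?thesis using 2 nths
        by (intro exI[of _ "[]"] exI[of _ "nths us ?A @ nths vs ?B"]
            exI[of _ "\<lambda>x. lie_bracket L (us ! i) x"]) auto
    next
      case 3
      \<comment> \<open>Neither argument of the bracket is the varying slot, so both are constants;
        the zero is only a placeholder in a slot that is never read.\<close>
      define b where "b l = (us @ \<zero>\<^bsub>L\<^esub> # vs) ! l" for l
      have "(us @ x # vs) ! i = b i" "(us @ x # vs) ! j = b j" for x
        using 3 by (auto simp: b_def nth_append nth_Cons')
      then show ?thesis using 3 nths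
        by (intro exI[of _ "lie_bracket L (b i) (b j) # nths us ?A"] exI[of _ "nths vs ?B"] exI[of _ "\<lambda>x. x"]) auto
    qed
  qed
  show ?thesis
  proof (rule multilinearI)
    show "?\<phi> xs \<in> carrier P" if "xs \<in> tuples L n" for xs
      using multilinearD(1)[OF assms(1)] bracket_term_tuples[OF that assms(2,3)] .
  next
    fix us vs x y assume xy: "us @ x # vs \<in> tuples L n" "us @ y # vs \<in> tuples L n"
    obtain us' vs' f where f: "f = (\<lambda>x. x) \<or> (\<exists>z \<in> carrier L. f = (\<lambda>x. lie_bracket L x z)) \<or>
        (\<exists>z \<in> carrier L. f = (\<lambda>x. lie_bracket L z x))"
      and eq: "\<And>x. lie_bracket L ((us @ x # vs) ! i) ((us @ x # vs) ! j) # nths (us @ x # vs) (- {i, j})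
        = us' @ f x # vs'" using *[OF xy(1)] by blast
    have "f (x \<oplus>\<^bsub>L\<^esub> y) = f x \<oplus>\<^bsub>L\<^esub> f y"
      using f xy by (auto simp: tuples_middle_iff bracket_add_left bracket_add_right)
    then show "?\<phi> (us @ (x \<oplus>\<^bsub>L\<^esub> y) # vs) = ?\<phi> (us @ x # vs) \<oplus>\<^bsub>P\<^esub> ?\<phi> (us @ y # vs)"
      using multilinearD(2)[OF assms(1)] bracket_term_tuples[OF xy(1) assms(2,3)]
        bracket_term_tuples[OF xy(2) assms(2,3)] by (simp add: eq)
  next
    fix us vs r x assume xy: "r \<in> carrier R" "us @ x # vs \<in> tuples L n"
    obtain us' vs' f where f: "f = (\<lambda>x. x) \<or> (\<exists>z \<in> carrier L. f = (\<lambda>x. lie_bracket L x z)) \<or>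
        (\<exists>z \<in> carrier L. f = (\<lambda>x. lie_bracket L z x))"
      and eq: "\<And>x. lie_bracket L ((us @ x # vs) ! i) ((us @ x # vs) ! j) # nths (us @ x # vs) (- {i, j})
        = us' @ f x # vs'" using *[OF xy(2)] by blast
    have "f (r \<odot>\<^bsub>L\<^esub> x) = r \<odot>\<^bsub>L\<^esub> f x"
      using f xy by (auto simp: tuples_middle_iff bracket_smult_left bracket_smult_right)
    then show "?\<phi> (us @ (r \<odot>\<^bsub>L\<^esub> x) # vs) = r \<odot>\<^bsub>P\<^esub> ?\<phi> (us @ x # vs)"
      using multilinearD(3)[OF assms(1)] bracket_term_tuples[OF xy(2) assms(2,3)] xy(1) by (simp add: eq)
  qed
qed

text \<open>The boundary as a function of tuples. It is available before the boundary is known to be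
  well defined on the exterior power, which is what its alternation has to establish.\<close>

definition ce_form :: "nat \<Rightarrow> 'b list \<Rightarrow> ('b list \<Rightarrow> 'a) set" where
  "ce_form n xs = (\<Oplus>\<^bsub>ext_power R L (n - 1)\<^esub>j\<in>{..<n}. \<Oplus>\<^bsub>ext_power R L (n - 1)\<^esub>i\<in>{..<j}.
     ((\<ominus> \<one>) [^] (i + j)) \<odot>\<^bsub>ext_power R L (n - 1)\<^esub>
       wedge R L (lie_bracket L (xs ! i) (xs ! j) # nths xs (- {i, j})))"

lemma ce_boundary_eq: "ce_boundary R L n = quot_map (linear_ext R (ext_power R L (n - 1)) (ce_form n))"
  by (simp add: ce_boundary_def ce_form_def[abs_def])

lemma ce_form_multilinear: "multilinear R L (ext_power R L (n - 1)) n (ce_form n)"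
proof -
  interpret E: module R "ext_power R L (n - 1)" by (rule ext_power_module)
  show ?thesis
    unfolding ce_form_def
    by (intro multilinear_finsum module_axioms E.module_axioms finite_lessThan
        linear_map_multilinear[OF E.smult_linear] bracket_term_multilinear wedge_multilinear) auto
qed

text \<open>Multilinearity of \<open>ce_form\<close> holds in every degree. Alternation stays a
  premise and is discharged below in degrees 3 and 4, from the explicit formulas.\<close>

lemma ce_boundary_linear:
  assumes "\<And>xs. \<lbrakk>xs \<in> tuples L n; \<not> distinct xs\<rbrakk> \<Longrightarrow> ce_form n xs = \<zero>\<^bsub>ext_power R L (n - 1)\<^esub>"
  shows "linear_map R (ext_power R L n) (ext_power R L (n - 1)) (ce_boundary R L n)"
    and "xs \<in> tuples L n \<Longrightarrow> ce_boundary R L n (wedge R L xs) = ce_form n xs"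
  unfolding ce_boundary_eq
  using ext_power_universal[OF ext_power_module ce_form_multilinear assms] by blast+

section \<open>Explicit boundaries in degrees 3 and 4\<close>

lemma smult_sign:
  fixes n :: nat
  assumes "module R P" "x \<in> carrier P"
  shows "((\<ominus> \<one>) [^] n) \<odot>\<^bsub>P\<^esub> x = (if even n then x else \<ominus>\<^bsub>P\<^esub> x)"
proof -
  interpret P: module R P by fact
  have "(\<ominus> \<one>) [^] n = (if even n then \<one> else \<ominus> \<one>)"
    by (induct n) (auto simp: R.l_minus R.r_minus)
  then show ?thesis using assms(2) by (simp add: P.smult_l_minus)
qed

text \<open>The signs are the parities of \<open>i + j\<close> with indices counted from 0: the
  pairs (0,1) and (1,2) are odd, (0,2) is even.\<close>

lemma ce_form_3:
  assumes "a \<in> carrier L" "b \<in> carrier L" "c \<in> carrier L"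
  shows "ce_form 3 [a, b, c] = \<ominus>\<^bsub>ext_power R L 2\<^esub> wedge R L [lie_bracket L a b, c]
    \<oplus>\<^bsub>ext_power R L 2\<^esub> (wedge R L [lie_bracket L a c, b]
    \<oplus>\<^bsub>ext_power R L 2\<^esub> \<ominus>\<^bsub>ext_power R L 2\<^esub> wedge R L [lie_bracket L b c, a])"
proof -
  interpret E: module R "ext_power R L 2" by (rule ext_power_module)
  let ?t = "\<lambda>i j. wedge R L (lie_bracket L ([a, b, c] ! i) ([a, b, c] ! j) # nths [a, b, c] (- {i, j}))"
  have t: "?t i j \<in> carrier (ext_power R L 2)" if "i < j" "j < 3" for i j
    using multilinearD(1)[OF wedge_multilinear bracket_term_tuples[OF _ that]] assms by (simp add: tuples_def)
  \<comment> \<open>Naming the signed term keeps it folded until the double sum is expanded; each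
    sign is then resolved for a pair whose term is known to lie in the carrier.\<close>
  define G where "G i j = ((\<ominus> \<one>) [^] (i + j)) \<odot>\<^bsub>ext_power R L 2\<^esub> ?t i j" for i j :: nat
  have G: "G i j = (if even (i + j) then ?t i j else \<ominus>\<^bsub>ext_power R L 2\<^esub> ?t i j)" if "i < j" "j < 3" for i j
    by (simp only: G_def smult_sign[OF E.module_axioms t[OF that]])
  have "ce_form 3 [a, b, c] = (\<Oplus>\<^bsub>ext_power R L 2\<^esub>j\<in>{..<3}. \<Oplus>\<^bsub>ext_power R L 2\<^esub>i\<in>{..<j}. G i j)"
    by (simp add: ce_form_def G_def)
  also have "\<dots> = G 0 1 \<oplus>\<^bsub>ext_power R L 2\<^esub> (G 0 2 \<oplus>\<^bsub>ext_power R L 2\<^esub> G 1 2)"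
    using t by (intro E.M.finsum_pairs(1)) (auto simp: G_def)
  finally show ?thesis by (simp add: G nths_Cons)
qed

lemma ce_form_4:
  assumes "a \<in> carrier L" "b \<in> carrier L" "c \<in> carrier L" "d \<in> carrier L"
  shows "ce_form 4 [a, b, c, d] = \<ominus>\<^bsub>ext_power R L 3\<^esub> wedge R L [lie_bracket L a b, c, d]
    \<oplus>\<^bsub>ext_power R L 3\<^esub> (wedge R L [lie_bracket L a c, b, d]
    \<oplus>\<^bsub>ext_power R L 3\<^esub> (\<ominus>\<^bsub>ext_power R L 3\<^esub> wedge R L [lie_bracket L b c, a, d]
    \<oplus>\<^bsub>ext_power R L 3\<^esub> (\<ominus>\<^bsub>ext_power R L 3\<^esub> wedge R L [lie_bracket L a d, b, c]
    \<oplus>\<^bsub>ext_power R L 3\<^esub> (wedge R L [lie_bracket L b d, a, c]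
    \<oplus>\<^bsub>ext_power R L 3\<^esub> \<ominus>\<^bsub>ext_power R L 3\<^esub> wedge R L [lie_bracket L c d, a, b]))))"
proof -
  interpret E: module R "ext_power R L 3" by (rule ext_power_module)
  let ?t = "\<lambda>i j. wedge R L (lie_bracket L ([a, b, c, d] ! i) ([a, b, c, d] ! j) # nths [a, b, c, d] (- {i, j}))"
  have t: "?t i j \<in> carrier (ext_power R L 3)" if "i < j" "j < 4" for i j
    using multilinearD(1)[OF wedge_multilinear bracket_term_tuples[OF _ that]] assms by (simp add: tuples_def)
  define G where "G i j = ((\<ominus> \<one>) [^] (i + j)) \<odot>\<^bsub>ext_power R L 3\<^esub> ?t i j" for i j :: nat
  have G: "G i j = (if even (i + j) then ?t i j else \<ominus>\<^bsub>ext_power R L 3\<^esub> ?t i j)" if "i < j" "j < 4" for i j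
    by (simp only: G_def smult_sign[OF E.module_axioms t[OF that]])
  have "ce_form 4 [a, b, c, d] = (\<Oplus>\<^bsub>ext_power R L 3\<^esub>j\<in>{..<4}. \<Oplus>\<^bsub>ext_power R L 3\<^esub>i\<in>{..<j}. G i j)"
    by (simp add: ce_form_def G_def)
  also have "\<dots> = G 0 1 \<oplus>\<^bsub>ext_power R L 3\<^esub> (G 0 2 \<oplus>\<^bsub>ext_power R L 3\<^esub> (G 1 2 \<oplus>\<^bsub>ext_power R L 3\<^esub> (G 0 3 \<oplus>\<^bsub>ext_power R L 3\<^esub> (G 1 3 \<oplus>\<^bsub>ext_power R L 3\<^esub> G 2 3))))"
    using t by (intro E.M.finsum_pairs(2)) (auto simp: G_def)
  finally show ?thesis by (simp add: G nths_Cons)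
qed

text \<open>The term that brackets the two equal entries vanishes and the other two cancel. For
  \<open>a = c\<close> the cancellation uses antisymmetry of the bracket.\<close>

lemma ce_form_3_alternating:
  assumes "xs \<in> tuples L 3" "\<not> distinct xs"
  shows "ce_form 3 xs = \<zero>\<^bsub>ext_power R L 2\<^esub>"
proof -
  let ?E = "ext_power R L 2"
  interpret E: module R ?E by (rule ext_power_module)
  obtain a b c where xs: "xs = [a, b, c]" and c: "a \<in> carrier L" "b \<in> carrier L" "c \<in> carrier L"
    using assms(1) by (auto simp: numeral_3_eq_3 tuples_Suc_conv)
  have mz: "\<ominus>\<^bsub>?E\<^esub> \<zero>\<^bsub>?E\<^esub> = \<zero>\<^bsub>?E\<^esub>" by (rule E.M.minus_equality) simp_all
  note ml = wedge_multilinear[of 2]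
  have w: "wedge R L [x, y] \<in> carrier ?E" if "x \<in> carrier L" "y \<in> carrier L" for x y
    using multilinearD(1)[OF ml] that by (simp add: tuples_def)
  have w0: "wedge R L [\<zero>\<^bsub>L\<^esub>, y] = \<zero>\<^bsub>?E\<^esub>" if "y \<in> carrier L" for y
    using multilinear_zero[OF E.module_axioms ml, of "[]" "[y]"] that by (simp add: tuples_def)
  have wm: "wedge R L [\<ominus>\<^bsub>L\<^esub> x, y] = \<ominus>\<^bsub>?E\<^esub> wedge R L [x, y]" if "x \<in> carrier L" "y \<in> carrier L" for x y
    using multilinear_minus[OF E.module_axioms ml, of "[]" x "[y]"] that by (simp add: tuples_def)
  have ba: "lie_bracket L b a = \<ominus>\<^bsub>L\<^esub> lie_bracket L a b" by (rule bracket_antisym[OF c(1,2)])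
  consider "a = b" | "a = c" | "b = c" using assms(2) xs by auto
  then show ?thesis
    by cases (use c ba in \<open>simp_all add: xs ce_form_3 bracket_self bracket_closed w w0 wm mz E.M.r_neg E.M.l_neg\<close>)
qed

text \<open>Of the six terms, one brackets the two equal entries and one keeps both of them as wedge
  factors; these vanish. The remaining four cancel in pairs, up to antisymmetry of the bracket and a
  swap of the last two factors.\<close>

lemma ce_form_4_alternating:
  assumes "xs \<in> tuples L 4" "\<not> distinct xs"
  shows "ce_form 4 xs = \<zero>\<^bsub>ext_power R L 3\<^esub>"
proof -
  let ?E = "ext_power R L 3"
  interpret E: module R ?E by (rule ext_power_module)
  obtain a b c d where xs: "xs = [a, b, c, d]"
    and c: "a \<in> carrier L" "b \<in> carrier L" "c \<in> carrier L" "d \<in> carrier L"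
    using assms(1) by (auto simp: eval_nat_numeral tuples_Suc_conv)
  have mz: "\<ominus>\<^bsub>?E\<^esub> \<zero>\<^bsub>?E\<^esub> = \<zero>\<^bsub>?E\<^esub>" by (rule E.M.minus_equality) simp_all
  note ml = wedge_multilinear[of 3]
  have w: "wedge R L [x, y, z] \<in> carrier ?E" if "x \<in> carrier L" "y \<in> carrier L" "z \<in> carrier L" for x y z
    using multilinearD(1)[OF ml] that by (simp add: tuples_def)
  have w0: "wedge R L [\<zero>\<^bsub>L\<^esub>, y, z] = \<zero>\<^bsub>?E\<^esub>" if "y \<in> carrier L" "z \<in> carrier L" for y z
    using multilinear_zero[OF E.module_axioms ml, of "[]" "[y, z]"] that by (simp add: tuples_def)
  have wd: "wedge R L [x, y, y] = \<zero>\<^bsub>?E\<^esub>" if "x \<in> carrier L" "y \<in> carrier L" for x y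
    using wedge_alternating[of "[x, y, y]" 3] that by (simp add: tuples_def)
  have wm: "wedge R L [\<ominus>\<^bsub>L\<^esub> x, y, z] = \<ominus>\<^bsub>?E\<^esub> wedge R L [x, y, z]"
    if "x \<in> carrier L" "y \<in> carrier L" "z \<in> carrier L" for x y z
    using multilinear_minus[OF E.module_axioms ml, of "[]" x "[y, z]"] that by (simp add: tuples_def)
  have ws: "wedge R L [x, z, y] = \<ominus>\<^bsub>?E\<^esub> wedge R L [x, y, z]"
    if "x \<in> carrier L" "y \<in> carrier L" "z \<in> carrier L" for x y z
    using alternating_swap[OF E.module_axioms ml wedge_alternating, of "[x]" y z "[]"] that
    by (simp add: tuples_def)
  note anti = bracket_antisym[OF c(1,2)] bracket_antisym[OF c(1,3)] bracket_antisym[OF c(2,3)]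
  note simps = xs ce_form_4 bracket_self bracket_closed w w0 wd wm mz E.M.r_neg E.M.l_neg E.M.r_neg1 E.M.r_neg2 E.M.a_ac
  consider "a = b" | "a = c" | "a = d" | "b = c" | "b = d" | "c = d" using assms(2) xs by auto
  \<comment> \<open>The swap rule \<open>ws\<close> applies again to its own right-hand side, so
    only instances that impose a fixed order on two of the entries are used for rewriting.\<close>
  then show ?thesis
    by cases (use c anti ws[of _ c a] ws[of _ b a] ws[of _ c b] in \<open>simp_all add: simps\<close>)
qed

lemma ce_boundary_3:
  "xs \<in> tuples L 3 \<Longrightarrow> ce_boundary R L 3 (wedge R L xs) = ce_form 3 xs"
  using ce_boundary_linear(2)[of 3] ce_form_3_alternating by simp

lemma ce_boundary_4:
  shows "linear_map R (ext_power R L 4) (ext_power R L 3) (ce_boundary R L 4)"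
    and "xs \<in> tuples L 4 \<Longrightarrow> ce_boundary R L 4 (wedge R L xs) = ce_form 4 xs"
  using ce_boundary_linear[of 4] ce_form_4_alternating by simp_all

end

section \<open>The symmetric square and the Koszul map\<close>

context module
begin

abbreviation S2 where "S2 \<equiv> sym_power R M 2"

lemma sym_power_module: "module R (sym_power R M n)"
proof -
  interpret power_module R M n "symmetric_rels R M n" by (rule power_module_sym)
  show ?thesis unfolding sym_power_def by (rule T.quot_module)
qed

lemma
  assumes "x \<in> carrier M" "y \<in> carrier M"
  shows sym_prod_closed: "sym_prod R M x y \<in> carrier S2"
    and sym_prod_add_left: "x' \<in> carrier M \<Longrightarrow>
      sym_prod R M (x \<oplus>\<^bsub>M\<^esub> x') y = sym_prod R M x y \<oplus>\<^bsub>S2\<^esub> sym_prod R M x' y"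
    and sym_prod_add_right: "y' \<in> carrier M \<Longrightarrow>
      sym_prod R M x (y \<oplus>\<^bsub>M\<^esub> y') = sym_prod R M x y \<oplus>\<^bsub>S2\<^esub> sym_prod R M x y'"
    and sym_prod_smult_left: "r \<in> carrier R \<Longrightarrow>
      sym_prod R M (r \<odot>\<^bsub>M\<^esub> x) y = r \<odot>\<^bsub>S2\<^esub> sym_prod R M x y"
    and sym_prod_smult_right: "r \<in> carrier R \<Longrightarrow>
      sym_prod R M x (r \<odot>\<^bsub>M\<^esub> y) = r \<odot>\<^bsub>S2\<^esub> sym_prod R M x y"
    and sym_prod_commute: "sym_prod R M y x = sym_prod R M x y"
proof -
  interpret power_module R M 2 "symmetric_rels R M 2" by (rule power_module_sym)
  have *: "[u, v] \<in> tuples M 2" if "u \<in> carrier M" "v \<in> carrier M" for u v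
    using that by (simp add: tuples_def)
  note D = multilinearD[OF gen_class_multilinear]
  show "sym_prod R M x y \<in> carrier S2"
    unfolding sym_prod_def sym_power_def using D(1)[OF *] assms by blast
  show "x' \<in> carrier M \<Longrightarrow>
      sym_prod R M (x \<oplus>\<^bsub>M\<^esub> x') y = sym_prod R M x y \<oplus>\<^bsub>S2\<^esub> sym_prod R M x' y"
    unfolding sym_prod_def sym_power_def using D(2)[of "[]" x "[y]" x'] * assms by simp
  show "y' \<in> carrier M \<Longrightarrow>
      sym_prod R M x (y \<oplus>\<^bsub>M\<^esub> y') = sym_prod R M x y \<oplus>\<^bsub>S2\<^esub> sym_prod R M x y'"
    unfolding sym_prod_def sym_power_def using D(2)[of "[x]" y "[]" y'] * assms by simp
  show "r \<in> carrier R \<Longrightarrow> sym_prod R M (r \<odot>\<^bsub>M\<^esub> x) y = r \<odot>\<^bsub>S2\<^esub> sym_prod R M x y"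
    unfolding sym_prod_def sym_power_def using D(3)[of r "[]" x "[y]"] * assms by simp
  show "r \<in> carrier R \<Longrightarrow> sym_prod R M x (r \<odot>\<^bsub>M\<^esub> y) = r \<odot>\<^bsub>S2\<^esub> sym_prod R M x y"
    unfolding sym_prod_def sym_power_def using D(3)[of r "[x]" y "[]"] * assms by simp
  have "free_gen R [y, x] \<ominus>\<^bsub>F\<^esub> free_gen R [x, y] \<in> symmetric_rels R M 2"
    unfolding symmetric_rels_def
    by (rule CollectI, intro exI conjI) (rule refl *[OF assms(2,1)] | simp)+
  then have "free_gen R [y, x] \<ominus>\<^bsub>F\<^esub> free_gen R [x, y] \<in> N"
    by (intro rel_mem UnI2)
  then show "sym_prod R M y x = sym_prod R M x y"
    unfolding sym_prod_def using * assms by (intro T.coset_eqI gen_carrier) auto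
qed

lemma sym_square_universal:
  assumes "module R P" "multilinear R M P 2 (\<lambda>xs. g (xs ! 0) (xs ! 1))"
    and comm: "\<And>x y. \<lbrakk>x \<in> carrier M; y \<in> carrier M\<rbrakk> \<Longrightarrow> g y x = g x y"
  obtains f where "linear_map R S2 P f"
    "\<And>x y. \<lbrakk>x \<in> carrier M; y \<in> carrier M\<rbrakk> \<Longrightarrow> f (sym_prod R M x y) = g x y"
proof -
  interpret P: module R P by fact
  interpret power_module R M 2 "symmetric_rels R M 2" by (rule power_module_sym)
  let ?\<phi> = "\<lambda>xs. g (xs ! 0) (xs ! 1)"
  have \<phi>: "?\<phi> \<in> tuples M 2 \<rightarrow> carrier P" using assms(2) by (simp add: multilinear_def)
  interpret f: linear_map R F P "linear_ext R P ?\<phi>" by (rule P.linear_ext_linear[OF \<phi>])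
  have "linear_ext R P ?\<phi> s = \<zero>\<^bsub>P\<^esub>" if s: "s \<in> symmetric_rels R M 2" for s
  proof -
    obtain xs ys where xs: "xs \<in> tuples M 2" "mset ys = mset xs" "s = free_gen R xs \<ominus>\<^bsub>F\<^esub> free_gen R ys"
      using s unfolding symmetric_rels_def by (elim CollectE exE conjE)
    have ys: "ys \<in> tuples M 2"
      using xs(1) mset_eq_setD[OF xs(2)] mset_eq_length[OF xs(2)] by (auto simp: tuples_def)
    \<comment> \<open>A rearrangement of a pair is the pair itself or its swap, so
      \<open>comm\<close> is all that is needed.\<close>
    have "?\<phi> xs = ?\<phi> ys"
      using xs(1,2) ys comm by (auto simp: numeral_2_eq_2 tuples_Suc_conv add_eq_conv_diff)
    then have "linear_ext R P ?\<phi> s = ?\<phi> xs \<ominus>\<^bsub>P\<^esub> ?\<phi> xs"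
      by (simp only: xs(3) f.map_diff[OF gen_carrier[OF xs(1)] gen_carrier[OF ys]]
          P.linear_ext_gen[OF \<phi> xs(1)] P.linear_ext_gen[OF \<phi> ys])
    then show ?thesis using funcset_mem[OF \<phi> xs(1)] by (simp only: P.M.minus_eq P.M.r_neg)
  qed
  note u = universal_property[OF assms(1,2) this]
  have "quot_map (linear_ext R P ?\<phi>) (sym_prod R M x y) = g x y"
    if "x \<in> carrier M" "y \<in> carrier M" for x y
    unfolding sym_prod_def using u(2)[of "[x, y]"] that by (simp add: tuples_def)
  with u(1) show thesis unfolding sym_power_def[symmetric] by (rule that)
qed

end

section \<open>The Killing module and the Koszul map\<close>

context lie_algebra
begin

abbreviation kill_generator where
  "kill_generator x y z \<equiv> sym_prod R L (lie_bracket L x y) z \<ominus>\<^bsub>S2\<^esub> sym_prod R L x (lie_bracket L y z)"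

text \<open>The relations form the image of the whole tensor cube, not just of pure tensors. As that
  cube is spanned by classes of triples, a linear map kills all relations once it kills each
  \<open>kill_generator\<close>; this is how forms will be made to factor through the Killing
  module.\<close>

lemma
  shows kill_rel_submodule: "submodule (kill_rel R L) R S2"
    and kill_generator_mem: "\<lbrakk>x \<in> carrier L; y \<in> carrier L; z \<in> carrier L\<rbrakk> \<Longrightarrow> kill_generator x y z \<in> kill_rel R L"
    and kill_rel_vanish: "\<lbrakk>linear_map R S2 P f;
      \<And>x y z. \<lbrakk>x \<in> carrier L; y \<in> carrier L; z \<in> carrier L\<rbrakk> \<Longrightarrow> f (kill_generator x y z) = \<zero>\<^bsub>P\<^esub>;
      s \<in> kill_rel R L\<rbrakk> \<Longrightarrow> f s = \<zero>\<^bsub>P\<^esub>"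
proof -
  interpret S: module R S2 by (rule sym_power_module)
  interpret power_module R L 3 "{}" by (rule power_module_tensor)
  have T: "tensor_power R L 3 = T" by (simp add: tensor_power_def)
  let ?\<phi> = "\<lambda>xs. kill_generator (xs ! 0) (xs ! 1) (xs ! 2)"
  note bracket = bracket_closed bracket_add_left bracket_add_right bracket_smult_left bracket_smult_right
  note prod = sym_prod_closed sym_prod_add_left sym_prod_add_right sym_prod_smult_left sym_prod_smult_right
  have "multilinear R L S2 3 ?\<phi>"
    by (rule multilinear3I)
      (simp_all add: prod bracket S.M.minus_eq S.M.minus_add S.M.a_ac S.smult_r_distr S.smult_r_minus)
  note u = universal_property[OF S.module_axioms this]
  have lin: "linear_map R (tensor_power R L 3) S2 (kill_rel_map R L)"
    unfolding T kill_rel_map_def by (rule u(1)) simp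
  interpret k: linear_map R "tensor_power R L 3" S2 "kill_rel_map R L" by (rule lin)
  show "submodule (kill_rel R L) R S2" unfolding kill_rel_def by (rule k.image_submodule)
  have val: "kill_rel_map R L (gen_class xs) = ?\<phi> xs" if "xs \<in> tuples L 3" for xs
    unfolding kill_rel_map_def by (rule u(2)) (use that in auto)
  have car: "gen_class xs \<in> carrier (tensor_power R L 3)" if "xs \<in> tuples L 3" for xs
    unfolding T using multilinearD(1)[OF gen_class_multilinear that] .
  show "kill_generator x y z \<in> kill_rel R L" if "x \<in> carrier L" "y \<in> carrier L" "z \<in> carrier L"
    unfolding kill_rel_def using val[of "[x, y, z]"] car[of "[x, y, z]"] that
    by (intro image_eqI[of _ _ "gen_class [x, y, z]"]) (simp_all add: tuples_def)
  assume f: "linear_map R S2 P f" and s: "s \<in> kill_rel R L"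
    and zero: "\<And>x y z. \<lbrakk>x \<in> carrier L; y \<in> carrier L; z \<in> carrier L\<rbrakk> \<Longrightarrow> f (kill_generator x y z) = \<zero>\<^bsub>P\<^esub>"
  obtain X where X: "X \<in> carrier T" "s = kill_rel_map R L X" using s unfolding kill_rel_def T by blast
  show "f s = \<zero>\<^bsub>P\<^esub>"
    unfolding X(2)
  proof (rule linear_map_zeroI[OF linear_map_comp[OF lin[unfolded T] f] _ X(1)])
    show "f (kill_rel_map R L (gen_class xs)) = \<zero>\<^bsub>P\<^esub>" if "xs \<in> tuples L 3" for xs
      using that by (simp only: val) (auto simp: numeral_3_eq_3 tuples_Suc_conv intro!: zero)
  qed
qed

sublocale kill: quotient_module R S2 "kill_rel R L"
  by (intro quotient_module.intro sym_power_module kill_rel_submodule)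

lemma kill_module_module: "module R (kill_module R L)"
  unfolding kill_module_def by (rule kill.quot_module)

abbreviation kill_class where "kill_class s \<equiv> kill_rel R L +>\<^bsub>S2\<^esub> s"

lemma kill_class_linear: "linear_map R S2 (kill_module R L) kill_class"
  unfolding kill_module_def by (rule kill.coset_linear)

lemma kill_class_eq_zero_iff: "s \<in> carrier S2 \<Longrightarrow> kill_class s = \<zero>\<^bsub>kill_module R L\<^esub> \<longleftrightarrow> s \<in> kill_rel R L"
  unfolding kill_module_def by (rule kill.coset_eq_zero_iff)

lemma kill_class_assoc:
  assumes "x \<in> carrier L" "y \<in> carrier L" "z \<in> carrier L"
  shows "kill_class (sym_prod R L (lie_bracket L x y) z) = kill_class (sym_prod R L x (lie_bracket L y z))"
  using assms by (intro kill.coset_eqI kill_generator_mem sym_prod_closed bracket_closed)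

text \<open>What has to be checked is alternation, and the Killing relation supplies it by moving
  the bracket onto the two equal entries: a \<odot> [a,b] = [a,a] \<odot> b. When the first and last
  entries agree, commutativity comes first: a \<odot> [b,a] = [b,a] \<odot> a = b \<odot>
  [a,a].\<close>

lemma
  shows koszul_map_linear: "linear_map R (ext_power R L 3) (kill_module R L) (koszul_map R L)"
    and koszul_map_wedge: "\<lbrakk>x \<in> carrier L; y \<in> carrier L; z \<in> carrier L\<rbrakk> \<Longrightarrow>
      koszul_map R L (wedge R L [x, y, z]) = kill_class (sym_prod R L x (lie_bracket L y z))"
proof -
  interpret S: module R S2 by (rule sym_power_module)
  interpret K: module R "kill_module R L" by (rule kill_module_module)
  interpret k: linear_map R S2 "kill_module R L" kill_class by (rule kill_class_linear)
  let ?\<phi> = "\<lambda>xs. kill_class (sym_prod R L (xs ! 0) (lie_bracket L (xs ! 1) (xs ! 2)))"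
  note bracket = bracket_closed bracket_add_left bracket_add_right bracket_smult_left bracket_smult_right
  note prod = sym_prod_closed sym_prod_add_left sym_prod_add_right sym_prod_smult_left sym_prod_smult_right
  have ml: "multilinear R L (kill_module R L) 3 ?\<phi>"
    by (rule multilinear3I) (simp_all add: prod bracket k.map_add k.map_smult)
  have z: "sym_prod R L \<zero>\<^bsub>L\<^esub> x = \<zero>\<^bsub>S2\<^esub>" "sym_prod R L x \<zero>\<^bsub>L\<^esub> = \<zero>\<^bsub>S2\<^esub>" if "x \<in> carrier L" for x
    using sym_prod_smult_left[of "\<zero>\<^bsub>L\<^esub>" x \<zero>] sym_prod_smult_right[of x "\<zero>\<^bsub>L\<^esub>" \<zero>] that
    by (simp_all add: sym_prod_closed)
  have aab: "kill_class (sym_prod R L a (lie_bracket L a b)) = \<zero>\<^bsub>kill_module R L\<^esub>"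
    if "a \<in> carrier L" "b \<in> carrier L" for a b
    using kill_class_assoc[of a a b] that by (simp add: bracket_self z)
  have aba: "kill_class (sym_prod R L a (lie_bracket L b a)) = \<zero>\<^bsub>kill_module R L\<^esub>"
    if "a \<in> carrier L" "b \<in> carrier L" for a b
  proof -
    have "kill_class (sym_prod R L a (lie_bracket L b a)) = kill_class (sym_prod R L (lie_bracket L b a) a)"
      using that by (simp add: sym_prod_commute bracket_closed)
    also have "\<dots> = \<zero>\<^bsub>kill_module R L\<^esub>"
      using kill_class_assoc[of b a a] that by (simp add: bracket_self z)
    finally show ?thesis .
  qed
  have "?\<phi> xs = \<zero>\<^bsub>kill_module R L\<^esub>" if "xs \<in> tuples L 3" "\<not> distinct xs" for xs
    using that by (auto simp: numeral_3_eq_3 tuples_Suc_conv aab aba bracket_self z)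
  note u = ext_power_universal[OF K.module_axioms ml this]
  show "linear_map R (ext_power R L 3) (kill_module R L) (koszul_map R L)"
    unfolding koszul_map_def by (rule u(1))
  show "koszul_map R L (wedge R L [x, y, z]) = kill_class (sym_prod R L x (lie_bracket L y z))"
    if "x \<in> carrier L" "y \<in> carrier L" "z \<in> carrier L"
    unfolding koszul_map_def using u(2)[of "[x, y, z]"] that by (simp add: tuples_def)
qed

text \<open>Each of the six terms of a boundary vanishes separately. Its first factor is a bracket
  [x,y], so its image is the class of [x,y] \<odot> [u,v], which equals that of x \<odot> [y,[u,v]],
  where the double bracket is zero.\<close>

lemma koszul_map_boundaries:
  assumes nil: "\<And>x y z. \<lbrakk>x \<in> carrier L; y \<in> carrier L; z \<in> carrier L\<rbrakk> \<Longrightarrow>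
      lie_bracket L x (lie_bracket L y z) = \<zero>\<^bsub>L\<^esub>"
    and "b \<in> ce_boundaries R L 3"
  shows "koszul_map R L b = \<zero>\<^bsub>kill_module R L\<^esub>"
proof -
  interpret E: module R "ext_power R L 3" by (rule ext_power_module)
  interpret K: module R "kill_module R L" by (rule kill_module_module)
  interpret \<eta>: linear_map R "ext_power R L 3" "kill_module R L" "koszul_map R L" by (rule koszul_map_linear)
  interpret k: linear_map R S2 "kill_module R L" kill_class by (rule kill_class_linear)
  have z: "sym_prod R L x \<zero>\<^bsub>L\<^esub> = \<zero>\<^bsub>S2\<^esub>" if "x \<in> carrier L" for x
    using sym_prod_smult_right[of x "\<zero>\<^bsub>L\<^esub>" \<zero>] that by (simp add: sym_prod_closed)
  have w: "wedge R L [x, y, z] \<in> carrier (ext_power R L 3)"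
    if "x \<in> carrier L" "y \<in> carrier L" "z \<in> carrier L" for x y z
    using multilinearD(1)[OF wedge_multilinear, of _ 3] that by (simp add: tuples_def)
  have \<eta>: "koszul_map R L (wedge R L [lie_bracket L x y, u, v]) = \<zero>\<^bsub>kill_module R L\<^esub>"
    if "x \<in> carrier L" "y \<in> carrier L" "u \<in> carrier L" "v \<in> carrier L" for x y u v
    using that kill_class_assoc[of x y "lie_bracket L u v"] by (simp add: koszul_map_wedge bracket_closed nil z)
  have mz: "\<ominus>\<^bsub>kill_module R L\<^esub> \<zero>\<^bsub>kill_module R L\<^esub> = \<zero>\<^bsub>kill_module R L\<^esub>" by (rule K.M.minus_equality) simp_all
  obtain X where X: "X \<in> carrier (ext_power R L 4)" "b = ce_boundary R L 4 X"
    using assms(2) by (auto simp: ce_boundaries_def)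
  show ?thesis
    unfolding X(2)
  proof (rule ext_power_zeroI[OF linear_map_comp[OF ce_boundary_4(1) koszul_map_linear] _ X(1)])
    fix xs assume xs: "xs \<in> tuples L 4"
    then obtain a b c d where "xs = [a, b, c, d]"
      and c: "a \<in> carrier L" "b \<in> carrier L" "c \<in> carrier L" "d \<in> carrier L"
      by (auto simp: eval_nat_numeral tuples_Suc_conv)
    then show "koszul_map R L (ce_boundary R L 4 (wedge R L xs)) = \<zero>\<^bsub>kill_module R L\<^esub>"
      unfolding ce_boundary_4(2)[OF xs] using c
      by (simp add: ce_form_4 \<eta>.map_add \<eta>.map_minus \<eta> mz w bracket_closed)
  qed
qed

text \<open>A criterion with the form \<open>\<beta>\<close> as witness. Symmetry makes
  \<open>\<beta>\<close> a linear map on the symmetric square and invariance makes it vanish on the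
  Killing relations, so a class on which it is nonzero cannot be zero.\<close>

lemma reduced_koszul_map_nonzero:
  assumes nil: "\<And>x y z. \<lbrakk>x \<in> carrier L; y \<in> carrier L; z \<in> carrier L\<rbrakk> \<Longrightarrow>
      lie_bracket L x (lie_bracket L y z) = \<zero>\<^bsub>L\<^esub>"
    and xyz: "x \<in> carrier L" "y \<in> carrier L" "z \<in> carrier L"
    and cycle: "ce_form 3 [x, y, z] = \<zero>\<^bsub>ext_power R L 2\<^esub>"
    and P: "module R P" "multilinear R L P 2 (\<lambda>xs. \<beta> (xs ! 0) (xs ! 1))"
    and sym: "\<And>x y. \<lbrakk>x \<in> carrier L; y \<in> carrier L\<rbrakk> \<Longrightarrow> \<beta> y x = \<beta> x y"
    and inv: "\<And>x y z. \<lbrakk>x \<in> carrier L; y \<in> carrier L; z \<in> carrier L\<rbrakk> \<Longrightarrow>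
      \<beta> (lie_bracket L x y) z = \<beta> x (lie_bracket L y z)"
    and nonzero: "\<beta> x (lie_bracket L y z) \<noteq> \<zero>\<^bsub>P\<^esub>"
  shows "\<exists>h \<in> carrier (ce_homology R L 3). reduced_koszul_map R L h \<noteq> \<zero>\<^bsub>kill_module R L\<^esub>"
proof -
  interpret E: module R "ext_power R L 3" by (rule ext_power_module)
  interpret E4: module R "ext_power R L 4" by (rule ext_power_module)
  interpret P: module R P by fact
  interpret \<partial>: linear_map R "ext_power R L 4" "ext_power R L 3" "ce_boundary R L 4" by (rule ce_boundary_4(1))
  interpret \<eta>: linear_map R "ext_power R L 3" "kill_module R L" "koszul_map R L" by (rule koszul_map_linear)
  let ?w = "wedge R L [x, y, z]" and ?B = "ce_boundaries R L 3" and ?v = "sym_prod R L x (lie_bracket L y z)"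
  have t: "[x, y, z] \<in> tuples L 3" using xyz by (simp add: tuples_def)
  have w: "?w \<in> carrier (ext_power R L 3)" by (rule multilinearD(1)[OF wedge_multilinear t])
  \<comment> \<open>The homology class of the cycle. Restricting the carrier to cycles leaves the
    addition unchanged, so the coset is a translate inside the exterior power.\<close>
  define h where "h = (\<lambda>b. b \<oplus>\<^bsub>ext_power R L 3\<^esub> ?w) ` ?B"
  have "?w \<in> ce_cycles R L 3"
    using w cycle ce_boundary_3[OF t] by (simp add: ce_cycles_def a_kernel_def')
  then have h: "h \<in> carrier (ce_homology R L 3)"
    by (auto simp: h_def ce_homology_def quot_module_def A_RCOSETS_def' a_r_coset_def')
  have B: "?B = ce_boundary R L 4 ` carrier (ext_power R L 4)" by (simp add: ce_boundaries_def)
  have "koszul_map R L (b \<oplus>\<^bsub>ext_power R L 3\<^esub> ?w) = koszul_map R L ?w" if "b \<in> ?B" for b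
  proof -
    have "b \<in> carrier (ext_power R L 3)" using that unfolding B by auto
    then show ?thesis using koszul_map_boundaries[OF nil that] w by (simp add: \<eta>.map_add)
  qed
  then have "koszul_map R L ` h = (\<lambda>b. koszul_map R L ?w) ` ?B"
    unfolding h_def image_image by (rule image_cong[OF refl])
  \<comment> \<open>The boundaries form a nonempty set, as the image of zero shows; hence the image
    of the coset is a true singleton and \<open>the_elem\<close> reads off its value.\<close>
  also have "\<dots> = {koszul_map R L ?w}" unfolding B using E4.M.zero_closed by blast
  finally have "reduced_koszul_map R L h = kill_class ?v"
    using koszul_map_wedge[OF xyz] by (simp add: reduced_koszul_map_def quot_map_def)
  moreover have "kill_class ?v \<noteq> \<zero>\<^bsub>kill_module R L\<^esub>"
  proof
    assume "kill_class ?v = \<zero>\<^bsub>kill_module R L\<^esub>"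
    then have v: "?v \<in> kill_rel R L"
      using xyz by (simp add: kill_class_eq_zero_iff sym_prod_closed bracket_closed)
    obtain f where f: "linear_map R S2 P f"
      and val: "\<And>x y. \<lbrakk>x \<in> carrier L; y \<in> carrier L\<rbrakk> \<Longrightarrow> f (sym_prod R L x y) = \<beta> x y"
      using sym_square_universal[OF P sym] by blast
    interpret f: linear_map R S2 P f by fact
    have "\<beta> a b \<in> carrier P" if "a \<in> carrier L" "b \<in> carrier L" for a b
      using f.closed[OF sym_prod_closed] val that by metis
    then have "f (kill_generator a b c) = \<zero>\<^bsub>P\<^esub>" if "a \<in> carrier L" "b \<in> carrier L" "c \<in> carrier L" for a b c
      using that by (simp add: f.map_diff val sym_prod_closed bracket_closed inv P.M.minus_eq P.M.r_neg)
    then have "f ?v = \<zero>\<^bsub>P\<^esub>" using kill_rel_vanish[OF f _ v] by blast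
    then show False using nonzero val xyz by (simp add: bracket_closed)
  qed
  ultimately show ?thesis using h by metis
qed

end

section \<open>The cross product scaled by a nilpotent element\<close>

text \<open>If \<open>m\<close> is the least exponent with \<open>a [^] m = \<zero>\<close>, then
  \<open>a [^] (m - 1)\<close> is nonzero, and its square has exponent 2m - 2 \<ge> m because m
  \<ge> 2.\<close>

lemma (in cring) exists_square_zero:
  assumes "\<not> reduced_ring R"
  obtains t where "t \<in> carrier R" "t \<noteq> \<zero>" "t \<otimes> t = \<zero>"
proof -
  obtain a n where a: "a \<in> carrier R" "a \<noteq> \<zero>" "a [^] (n::nat) = \<zero>"
    using assms by (auto simp: reduced_ring_def)
  define m where "m = (LEAST n::nat. a [^] n = \<zero>)"
  have m: "a [^] m = \<zero>" unfolding m_def using a(3) by (rule LeastI)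
  have least: "a [^] k \<noteq> \<zero>" if "k < m" for k using not_less_Least that unfolding m_def by blast
  \<comment> \<open>Exponent 0 would make the ring trivial, contradicting
    \<open>a \<noteq> \<zero>\<close>.\<close>
  have "m \<noteq> 0"
  proof
    assume "m = 0"
    then have "\<one> = \<zero>" using m by simp
    then show False using a(1,2) one_zeroD by auto
  qed
  moreover have "m \<noteq> 1" using m a by auto
  ultimately have "m - 1 < m" "m - 1 + (m - 1) = m + (m - 2)" by auto
  then have "a [^] (m - 1) \<otimes> a [^] (m - 1) = \<zero>"
    using a(1) m by (metis nat_pow_closed nat_pow_mult l_null)
  then show thesis using that[of "a [^] (m - 1)"] a(1) least[OF \<open>m - 1 < m\<close>] by simp
qed

section \<open>The ring as a module over itself, and the scaled cross product\<close>

definition regular_module :: "('a, 'm) ring_scheme \<Rightarrow> ('a, 'a) module" where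
  "regular_module R = \<lparr>carrier = carrier R, mult = mult R, one = one R, zero = zero R, add = add R,
     smult = mult R\<rparr>"

lemma regular_module_sel [simp]:
  "carrier (regular_module R) = carrier R" "zero (regular_module R) = zero R"
  "add (regular_module R) = add R" "smult (regular_module R) = mult R"
  by (simp_all add: regular_module_def)

lemma (in cring) regular_module_module: "module R (regular_module R)"
  by (intro moduleI abelian_groupI is_cring)
    (auto simp: l_distr r_distr m_assoc a_ac intro: l_neg bexI[of _ "\<ominus> _"])

text \<open>Vectors are functions on all natural numbers that vanish outside {0, 1, 2}; the last
  branch keeps the product among them.\<close>

definition cross_prod :: "('a, 'm) ring_scheme \<Rightarrow> (nat \<Rightarrow> 'a) \<Rightarrow> (nat \<Rightarrow> 'a) \<Rightarrow> nat \<Rightarrow> 'a" where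
  "cross_prod R x y = (\<lambda>i.
     if i = 0 then x 1 \<otimes>\<^bsub>R\<^esub> y 2 \<ominus>\<^bsub>R\<^esub> x 2 \<otimes>\<^bsub>R\<^esub> y 1
     else if i = 1 then x 2 \<otimes>\<^bsub>R\<^esub> y 0 \<ominus>\<^bsub>R\<^esub> x 0 \<otimes>\<^bsub>R\<^esub> y 2
     else if i = 2 then x 0 \<otimes>\<^bsub>R\<^esub> y 1 \<ominus>\<^bsub>R\<^esub> x 1 \<otimes>\<^bsub>R\<^esub> y 0 else \<zero>\<^bsub>R\<^esub>)"

definition dot_prod :: "('a, 'm) ring_scheme \<Rightarrow> (nat \<Rightarrow> 'a) \<Rightarrow> (nat \<Rightarrow> 'a) \<Rightarrow> 'a" where
  "dot_prod R x y = x 0 \<otimes>\<^bsub>R\<^esub> y 0 \<oplus>\<^bsub>R\<^esub> (x 1 \<otimes>\<^bsub>R\<^esub> y 1 \<oplus>\<^bsub>R\<^esub> x 2 \<otimes>\<^bsub>R\<^esub> y 2)"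

definition cross_lie :: "('a, 'm) ring_scheme \<Rightarrow> 'a \<Rightarrow> ('a, nat \<Rightarrow> 'a) lie_alg" where
  "cross_lie R t =
     (let F = free_module R {0, 1, 2} in
       \<lparr>carrier = carrier F, mult = undefined, one = undefined, zero = zero F, add = add F,
        smult = smult F, lie_bracket = (\<lambda>x y i. t \<otimes>\<^bsub>R\<^esub> cross_prod R x y i)\<rparr>)"

lemma cross_lie_sel:
  "x \<in> carrier (cross_lie R t) \<longleftrightarrow> (\<forall>i. x i \<in> carrier R) \<and> (\<forall>i. i \<notin> {0, 1, 2} \<longrightarrow> x i = \<zero>\<^bsub>R\<^esub>)"
  "zero (cross_lie R t) = (\<lambda>i. \<zero>\<^bsub>R\<^esub>)"
  "x \<oplus>\<^bsub>cross_lie R t\<^esub> y = (\<lambda>i. x i \<oplus>\<^bsub>R\<^esub> y i)"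
  "r \<odot>\<^bsub>cross_lie R t\<^esub> x = (\<lambda>i. r \<otimes>\<^bsub>R\<^esub> x i)"
  "lie_bracket (cross_lie R t) x y = (\<lambda>i. t \<otimes>\<^bsub>R\<^esub> cross_prod R x y i)"
proof -
  have fin: "finite {i. x i \<noteq> \<zero>\<^bsub>R\<^esub>}" if "{i. x i \<noteq> \<zero>\<^bsub>R\<^esub>} \<subseteq> {0, 1, 2}"
    using that by (rule finite_subset) simp
  have sub: "{i. x i \<noteq> \<zero>\<^bsub>R\<^esub>} \<subseteq> {0, 1, 2} \<longleftrightarrow> (\<forall>i. i \<notin> {0, 1, 2} \<longrightarrow> x i = \<zero>\<^bsub>R\<^esub>)" by blast
  have car: "carrier (cross_lie R t) = carrier (free_module R {0, 1, 2})"
    by (simp add: cross_lie_def Let_def)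
  show "x \<in> carrier (cross_lie R t) \<longleftrightarrow>
      (\<forall>i. x i \<in> carrier R) \<and> (\<forall>i. i \<notin> {0, 1, 2} \<longrightarrow> x i = \<zero>\<^bsub>R\<^esub>)"
    unfolding car free_module_carrier_iff sub[symmetric] using fin by iprover
qed (simp_all add: cross_lie_def Let_def free_module_sel)

context cring
begin

lemma cross_lie_module: "module R (cross_lie R t)"
proof -
  define F where "F = free_module R {0, 1, 2::nat}"
  interpret F: module R F unfolding F_def by (rule free_module_module) (rule is_cring)
  have s: "carrier (cross_lie R t) = carrier F" "zero (cross_lie R t) = zero F"
    "add (cross_lie R t) = add F" "smult (cross_lie R t) = smult F"
    by (simp_all add: cross_lie_def Let_def F_def)
  show ?thesis
    by (intro moduleI abelian_groupI is_cring)
      (auto simp: s F.smult_l_distr F.smult_r_distr F.smult_assoc1 F.M.a_ac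
        intro: F.M.l_neg bexI[of _ "\<ominus>\<^bsub>F\<^esub> _"])
qed

lemma cross_prod_closed:
  assumes "\<And>i. x i \<in> carrier R" "\<And>i. y i \<in> carrier R"
  shows "cross_prod R x y i \<in> carrier R"
  using assms by (simp add: cross_prod_def)

text \<open>The cross product is linear in the coordinates of \<open>y\<close>, so the factor
  \<open>t\<close> can be moved onto them. Asking that \<open>t\<close> annihilate \<open>y\<close>,
  rather than that \<open>y\<close> be a bracket, makes the lemma apply to sums of brackets
  too.\<close>

lemma cross_lie_double_bracket:
  assumes "t \<in> carrier R" "t \<otimes> t = \<zero>" "\<And>i. x i \<in> carrier R" "\<And>i. y i \<in> carrier R"
    and z: "\<And>i. t \<otimes> y i = \<zero>"
  shows "lie_bracket (cross_lie R t) x y = \<zero>\<^bsub>cross_lie R t\<^esub>"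
proof -
  have *: "t \<otimes> (x j \<otimes> y k \<ominus> x l \<otimes> y m) = \<zero>" for j k l m
  proof -
    have "t \<otimes> (a \<otimes> b \<ominus> c \<otimes> d) = a \<otimes> (t \<otimes> b) \<ominus> c \<otimes> (t \<otimes> d)"
      if "a \<in> carrier R" "b \<in> carrier R" "c \<in> carrier R" "d \<in> carrier R" for a b c d
      using assms(1) that by algebra
    then have "t \<otimes> (x j \<otimes> y k \<ominus> x l \<otimes> y m) = x j \<otimes> (t \<otimes> y k) \<ominus> x l \<otimes> (t \<otimes> y m)"
      using assms(3,4) by blast
    also have "\<dots> = \<zero>" using z assms(3) by (simp add: r_neg minus_eq)
    finally show ?thesis .
  qed
  show ?thesis
    using assms(1) by (auto simp: cross_lie_sel cross_prod_def fun_eq_iff *)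
qed

lemma cross_lie_bracket_annihilated:
  assumes "t \<in> carrier R" "t \<otimes> t = \<zero>" "\<And>i. x i \<in> carrier R" "\<And>i. y i \<in> carrier R"
  shows "t \<otimes> lie_bracket (cross_lie R t) x y i = \<zero>"
  using assms cross_prod_closed by (simp add: cross_lie_sel m_assoc[symmetric])

text \<open>The Jacobi identity is immediate here: all three double brackets vanish because
  \<open>t \<otimes> t = \<zero>\<close>.\<close>

lemma cross_lie_lie_algebra:
  assumes t: "t \<in> carrier R" "t \<otimes> t = \<zero>"
  shows "lie_algebra R (cross_lie R t)"
proof -
  let ?L = "cross_lie R t"
  interpret L: module R ?L by (rule cross_lie_module)
  have closed: "lie_bracket ?L x y \<in> carrier ?L" if "x \<in> carrier ?L" "y \<in> carrier ?L" for x y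
  proof -
    have "cross_prod R x y i \<in> carrier R" for i
      using that by (intro cross_prod_closed) (simp_all add: cross_lie_sel(1))
    moreover have "cross_prod R x y i = \<zero>" if "i \<notin> {0, 1, 2}" for i
      using that by (simp add: cross_prod_def)
    ultimately show ?thesis using t(1) by (simp add: cross_lie_sel(1,5))
  qed
  have nil: "lie_bracket ?L x (lie_bracket ?L y z) = \<zero>\<^bsub>?L\<^esub>"
    if "x \<in> carrier ?L" "y \<in> carrier ?L" "z \<in> carrier ?L" for x y z
    using that closed[OF that(2,3)]
    by (intro cross_lie_double_bracket t cross_lie_bracket_annihilated) (auto simp: cross_lie_sel(1))
  \<comment> \<open>Each coordinate of a bracket in {0, 1, 2} has the form s (a b - c d);
    bilinearity and the vanishing of [x,x] reduce to the following identities for such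
    expressions.\<close>
  have add: "s \<otimes> ((a \<oplus> a') \<otimes> b \<ominus> (c \<oplus> c') \<otimes> d) = s \<otimes> (a \<otimes> b \<ominus> c \<otimes> d) \<oplus> s \<otimes> (a' \<otimes> b \<ominus> c' \<otimes> d)"
    "s \<otimes> (b \<otimes> (a \<oplus> a') \<ominus> d \<otimes> (c \<oplus> c')) = s \<otimes> (b \<otimes> a \<ominus> d \<otimes> c) \<oplus> s \<otimes> (b \<otimes> a' \<ominus> d \<otimes> c')"
    if "s \<in> carrier R" "a \<in> carrier R" "a' \<in> carrier R" "b \<in> carrier R" "c \<in> carrier R"
      "c' \<in> carrier R" "d \<in> carrier R" for s a a' b c c' d
    using that by algebra+
  have smult: "s \<otimes> ((r \<otimes> a) \<otimes> b \<ominus> (r \<otimes> c) \<otimes> d) = r \<otimes> (s \<otimes> (a \<otimes> b \<ominus> c \<otimes> d))"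
    "s \<otimes> (a \<otimes> (r \<otimes> b) \<ominus> c \<otimes> (r \<otimes> d)) = r \<otimes> (s \<otimes> (a \<otimes> b \<ominus> c \<otimes> d))"
    if "s \<in> carrier R" "r \<in> carrier R" "a \<in> carrier R" "b \<in> carrier R" "c \<in> carrier R"
      "d \<in> carrier R" for s r a b c d
    using that by algebra+
  have self: "s \<otimes> (a \<otimes> b \<ominus> b \<otimes> a) = \<zero>" if "s \<in> carrier R" "a \<in> carrier R" "b \<in> carrier R" for s a b
    using that by algebra
  show ?thesis
    by (intro lie_algebra.intro lie_algebra_axioms.intro L.module_axioms closed)
      (simp_all add: nil, auto simp: cross_lie_sel cross_prod_def fun_eq_iff add smult self t)
qed

text \<open>The annihilator \<open>?N\<close> of \<open>t\<close> is the kernel of scaling by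
  \<open>t\<close>, hence a submodule. It contains all brackets and therefore their span, so
  bracketing with any element of that span gives zero.\<close>

lemma cross_lie_two_nilpotent:
  assumes t: "t \<in> carrier R" "t \<otimes> t = \<zero>"
  shows "two_nilpotent R (cross_lie R t)"
proof -
  let ?L = "cross_lie R t"
  interpret L: lie_algebra R ?L by (rule cross_lie_lie_algebra[OF t])
  let ?N = "{x \<in> carrier ?L. t \<odot>\<^bsub>?L\<^esub> x = \<zero>\<^bsub>?L\<^esub>}"
  have zero: "submodule {\<zero>\<^bsub>?L\<^esub>} R ?L" by (rule L.submoduleI) auto
  interpret t: linear_map R ?L ?L "\<lambda>x. t \<odot>\<^bsub>?L\<^esub> x" by (rule L.smult_linear[OF t(1)])
  have span: "bracket_span R ?L (carrier ?L) (carrier ?L) \<subseteq> ?N"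
    unfolding bracket_span_def
  proof (rule L.submodule_span_least[OF t.kernel_submodule], safe)
    fix x y assume "x \<in> carrier ?L" "y \<in> carrier ?L"
    then show "lie_bracket ?L x y \<in> carrier ?L" "t \<odot>\<^bsub>?L\<^esub> lie_bracket ?L x y = \<zero>\<^bsub>?L\<^esub>"
      using cross_lie_bracket_annihilated[OF t, of x y] L.bracket_closed
      by (simp_all add: cross_lie_sel(1,2,4))
  qed
  have "lie_bracket ?L x y = \<zero>\<^bsub>?L\<^esub>"
    if x: "x \<in> carrier ?L" and y: "y \<in> bracket_span R ?L (carrier ?L) (carrier ?L)" for x y
  proof (rule cross_lie_double_bracket[OF t])
    have "y \<in> ?N" using y span by blast
    then show "t \<otimes> y i = \<zero>" "y i \<in> carrier R" for i
      by (auto simp: cross_lie_sel(1,2,4) dest: fun_cong[of _ _ i])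
  qed (use x in \<open>simp add: cross_lie_sel(1)\<close>)
  then have "{lie_bracket ?L x y |x y. x \<in> carrier ?L \<and> y \<in> bracket_span R ?L (carrier ?L) (carrier ?L)}
      \<subseteq> {\<zero>\<^bsub>?L\<^esub>}" by blast
  then have "bracket_span R ?L (carrier ?L) (bracket_span R ?L (carrier ?L) (carrier ?L)) \<subseteq> {\<zero>\<^bsub>?L\<^esub>}"
    unfolding bracket_span_def[of _ _ _ "bracket_span R ?L (carrier ?L) (carrier ?L)"]
    by (rule L.submodule_span_least[OF zero])
  moreover have "\<zero>\<^bsub>?L\<^esub> \<in> bracket_span R ?L (carrier ?L) (bracket_span R ?L (carrier ?L) (carrier ?L))"
    by (auto simp: bracket_span_def submodule_span_def L.submodule_zero)
  ultimately show ?thesis unfolding two_nilpotent_def by blast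
qed

lemma dot_prod_multilinear:
  "multilinear R (cross_lie R t) (regular_module R) 2 (\<lambda>xs. dot_prod R (xs ! 0) (xs ! 1))"
proof -
  have *: "(a \<oplus> a') \<otimes> b \<oplus> ((c \<oplus> c') \<otimes> d \<oplus> (e \<oplus> e') \<otimes> f) =
      a \<otimes> b \<oplus> (c \<otimes> d \<oplus> e \<otimes> f) \<oplus> (a' \<otimes> b \<oplus> (c' \<otimes> d \<oplus> e' \<otimes> f))"
    "b \<otimes> (a \<oplus> a') \<oplus> (d \<otimes> (c \<oplus> c') \<oplus> f \<otimes> (e \<oplus> e')) =
      b \<otimes> a \<oplus> (d \<otimes> c \<oplus> f \<otimes> e) \<oplus> (b \<otimes> a' \<oplus> (d \<otimes> c' \<oplus> f \<otimes> e'))"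
    if "a \<in> carrier R" "a' \<in> carrier R" "b \<in> carrier R" "c \<in> carrier R" "c' \<in> carrier R"
      "d \<in> carrier R" "e \<in> carrier R" "e' \<in> carrier R" "f \<in> carrier R" for a a' b c c' d e e' f
    using that by algebra+
  have **: "(r \<otimes> a) \<otimes> b \<oplus> ((r \<otimes> c) \<otimes> d \<oplus> (r \<otimes> e) \<otimes> f) = r \<otimes> (a \<otimes> b \<oplus> (c \<otimes> d \<oplus> e \<otimes> f))"
    "a \<otimes> (r \<otimes> b) \<oplus> (c \<otimes> (r \<otimes> d) \<oplus> e \<otimes> (r \<otimes> f)) = r \<otimes> (a \<otimes> b \<oplus> (c \<otimes> d \<oplus> e \<otimes> f))"
    if "r \<in> carrier R" "a \<in> carrier R" "b \<in> carrier R" "c \<in> carrier R" "d \<in> carrier R"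
      "e \<in> carrier R" "f \<in> carrier R" for r a b c d e f
    using that by algebra+
  show ?thesis
    by (rule multilinear2I) (simp_all add: cross_lie_sel dot_prod_def * **)
qed

text \<open>Both sides are \<open>t\<close> times the scalar triple product, that is, the
  determinant with rows x, y, z.\<close>

lemma dot_prod_invariant:
  assumes "t \<in> carrier R" "\<And>i. x i \<in> carrier R" "\<And>i. y i \<in> carrier R" "\<And>i. z i \<in> carrier R"
  shows "dot_prod R (lie_bracket (cross_lie R t) x y) z = dot_prod R x (lie_bracket (cross_lie R t) y z)"
proof -
  have "t \<otimes> (x1 \<otimes> y2 \<ominus> x2 \<otimes> y1) \<otimes> z0 \<oplus>
      (t \<otimes> (x2 \<otimes> y0 \<ominus> x0 \<otimes> y2) \<otimes> z1 \<oplus> t \<otimes> (x0 \<otimes> y1 \<ominus> x1 \<otimes> y0) \<otimes> z2) =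
      x0 \<otimes> (t \<otimes> (y1 \<otimes> z2 \<ominus> y2 \<otimes> z1)) \<oplus>
      (x1 \<otimes> (t \<otimes> (y2 \<otimes> z0 \<ominus> y0 \<otimes> z2)) \<oplus> x2 \<otimes> (t \<otimes> (y0 \<otimes> z1 \<ominus> y1 \<otimes> z0)))"
    if "x0 \<in> carrier R" "x1 \<in> carrier R" "x2 \<in> carrier R" "y0 \<in> carrier R" "y1 \<in> carrier R"
      "y2 \<in> carrier R" "z0 \<in> carrier R" "z1 \<in> carrier R" "z2 \<in> carrier R" for x0 x1 x2 y0 y1 y2 z0 z1 z2
    using assms(1) that by algebra
  from this[of "x 0" "x 1" "x 2" "y 0" "y 1" "y 2" "z 0" "z 1" "z 2"] show ?thesis
    using assms by (simp add: cross_lie_sel dot_prod_def cross_prod_def)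
qed

end

theorem proposition3p7:
  fixes R :: "('a, 'm) ring_scheme"
  assumes "cring R"
    and "\<one>\<^bsub>R\<^esub> \<oplus>\<^bsub>R\<^esub> \<one>\<^bsub>R\<^esub> \<in> Units R"
    and "\<not> reduced_ring R"
  shows "\<exists>L :: ('a, nat \<Rightarrow> 'a) lie_alg.
           lie_algebra R L \<and> two_nilpotent R L \<and>
           (\<exists>h \<in> carrier (ce_homology R L 3).
              reduced_koszul_map R L h \<noteq> \<zero>\<^bsub>kill_module R L\<^esub>)"
proof -
  interpret cring R by fact
  obtain t where t: "t \<in> carrier R" "t \<noteq> \<zero>\<^bsub>R\<^esub>" "t \<otimes>\<^bsub>R\<^esub> t = \<zero>\<^bsub>R\<^esub>"
    using exists_square_zero[OF assms(3)] .
  let ?L = "cross_lie R t"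
  interpret L: lie_algebra R ?L by (rule cross_lie_lie_algebra[OF t(1,3)])
  interpret E: module R "ext_power R ?L 2" by (rule L.ext_power_module)
  let ?p = "free_gen R (0::nat)" and ?q = "free_gen R (1::nat)" and ?r = "free_gen R (2::nat)"
  have pqr: "?p \<in> carrier ?L" "?q \<in> carrier ?L" "?r \<in> carrier ?L"
    by (auto simp: cross_lie_sel free_gen_def)
  \<comment> \<open>The sign of p \<times> r = -q is put on the vector, so that each bracket reads
    as \<open>t\<close> times something.\<close>
  have brackets: "lie_bracket ?L ?p ?q = t \<odot>\<^bsub>?L\<^esub> ?r" "lie_bracket ?L ?q ?r = t \<odot>\<^bsub>?L\<^esub> ?p"
    "lie_bracket ?L ?p ?r = t \<odot>\<^bsub>?L\<^esub> (\<ominus>\<^bsub>?L\<^esub> ?q)"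
  proof -
    have "\<ominus>\<^bsub>?L\<^esub> ?q = (\<lambda>i. \<ominus>\<^bsub>R\<^esub> ?q i)"
      using pqr by (intro L.M.minus_equality) (auto simp: cross_lie_sel l_neg)
    then show "lie_bracket ?L ?p ?r = t \<odot>\<^bsub>?L\<^esub> (\<ominus>\<^bsub>?L\<^esub> ?q)"
      by (auto simp: cross_lie_sel cross_prod_def free_gen_def fun_eq_iff minus_eq)
  qed (auto simp: cross_lie_sel cross_prod_def free_gen_def fun_eq_iff minus_eq)
  have w: "wedge R ?L [s \<odot>\<^bsub>?L\<^esub> x, x] = \<zero>\<^bsub>ext_power R ?L 2\<^esub>" if "s \<in> carrier R" "x \<in> carrier ?L" for s x
    using multilinearD(3)[OF L.wedge_multilinear, of s "[]" x "[x]" 2] L.wedge_alternating[of "[x, x]" 2] that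
    by (simp add: tuples_def)
  have mz: "\<ominus>\<^bsub>ext_power R ?L 2\<^esub> \<zero>\<^bsub>ext_power R ?L 2\<^esub> = \<zero>\<^bsub>ext_power R ?L 2\<^esub>"
    by (rule E.M.minus_equality) simp_all
  \<comment> \<open>Moving the sign to the scalar turns the middle term of the boundary into a
    multiple of \<open>?q\<close> wedged with \<open>?q\<close>, the shape that \<open>w\<close>
    handles.\<close>
  have "t \<odot>\<^bsub>?L\<^esub> (\<ominus>\<^bsub>?L\<^esub> ?q) = (\<ominus>\<^bsub>R\<^esub> t) \<odot>\<^bsub>?L\<^esub> ?q"
    using t pqr by (simp add: L.smult_l_minus L.smult_r_minus)
  then have cycle: "L.ce_form 3 [?p, ?q, ?r] = \<zero>\<^bsub>ext_power R ?L 2\<^esub>"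
    \<comment> \<open>Simplification writes the index 1 as \<open>Suc 0\<close>, so the bracket
      equations are brought to the same form.\<close>
    using t pqr by (simp add: L.ce_form_3 brackets[unfolded One_nat_def] w mz)
  have nil: "lie_bracket ?L x (lie_bracket ?L y z) = \<zero>\<^bsub>?L\<^esub>"
    if "x \<in> carrier ?L" "y \<in> carrier ?L" "z \<in> carrier ?L" for x y z
    using that L.bracket_closed[OF that(2,3)]
    by (intro cross_lie_double_bracket t cross_lie_bracket_annihilated) (auto simp: cross_lie_sel(1))
  have "\<exists>h \<in> carrier (ce_homology R ?L 3). reduced_koszul_map R ?L h \<noteq> \<zero>\<^bsub>kill_module R ?L\<^esub>"
  proof (rule L.reduced_koszul_map_nonzero[OF nil pqr cycle regular_module_module dot_prod_multilinear])
    show "dot_prod R y x = dot_prod R x y" if "x \<in> carrier ?L" "y \<in> carrier ?L" for x y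
      using that by (simp add: cross_lie_sel dot_prod_def m_comm)
    show "dot_prod R (lie_bracket ?L x y) z = dot_prod R x (lie_bracket ?L y z)"
      if "x \<in> carrier ?L" "y \<in> carrier ?L" "z \<in> carrier ?L" for x y z
      using that t by (intro dot_prod_invariant) (auto simp: cross_lie_sel)
    \<comment> \<open>The determinant of the standard basis is one, so the value is \<open>t\<close>
      itself.\<close>
    show "dot_prod R ?p (lie_bracket ?L ?q ?r) \<noteq> \<zero>\<^bsub>regular_module R\<^esub>"
      using t by (simp add: cross_lie_sel dot_prod_def cross_prod_def free_gen_def minus_eq)
  qed
  then show ?thesis using L.lie_algebra_axioms cross_lie_two_nilpotent[OF t(1,3)] by blast
qed

end
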